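(* Let $G$ be an ADB-AC graph with a fixed planar annular embedding whose annuli $A_1,\dots,A_x$ (from the interior face outward) are each either a ring annulus or a block annulus. Call a maximal run of consecutive ring annuli that is preceded and followed by block annuli an enclosed run of ring annuli. If every enclosed run of ring annuli consists of at least $2$ annuli (i.e. there is no singular sequence of ring annuli between two sequences of block annuli), then $G$ is Hamiltonian.
   Context: A Barnette graph is a finite $3$-regular, $3$-connected, planar, bipartite graph. A Barnette graph $G$ is an $x$-annular decomposable Barnette graph ($x$-ADB graph; ADB graph if $x$ is unspecified) if it has a plane embedding (a planar annular embedding) with pairwise vertex-disjoint cycles $C_0,C_1,\dots,C_x$ of $G$, each $C_{k-1}$ lying in the bounded region of $C_k$, such that $C_0$ bounds a face (the interior face), $C_x$ bounds the unbounded face (the exterior face), every vertex lies on some $C_k$, and every edge is either an edge of some $C_k$ or joins a vertex of $C_{k-1}$ to a vertex of $C_k$ for some $1\le k\le x$. The closed region between $C_{k-1}$ and $C_k$ is the $k$-th annulus $A_k$; edges joining $C_{k-1}$ to $C_k$ lie in the interior of $A_k$; the faces of $G$ inside $A_k$ are the faces of $A_k$; $A_x$ is the outer annulus. Suppressing degree-$2$ vertices means replacing each maximal path whose internal vertices have degree $2$ by a single edge (a cycle all of whose vertices have degree $2$ becomes a vertex-less closed curve). An $x$-ADB graph with $x>2$ is annular connected (ADB-AC) if for every $k$, deleting the edges in the interior of $A_k$ and suppressing degree-$2$ vertices yields either two Barnette graphs or a Barnette graph and a vertex-less closed curve. For $1\le k<x$, the $k$-annular restriction $G_k$ is obtained from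 the subgraph consisting of $C_0,\dots,C_k$ and the edges in the interiors of $A_1,\dots,A_k$ by suppressing degree-$2$ vertices (those on $C_k$ incident to edges of $A_{k+1}$); its outer annulus $O(G_k)$ is its $k$-th annulus. The faces of an outer annulus are cyclically arranged, consecutive ones sharing an edge in the interior of the annulus; there is an even number of them, and they split into two alternating classes of pairwise non-adjacent faces; for ADB-AC graphs one class consists only of $4$-cycles, called the $4$-cycle class. For $k\ge 3$, each edge in the interior of $A_k$ has its endpoint on $C_{k-1}$ lying on an edge of the outer boundary of $G_{k-1}$, which belongs to a unique face of $O(G_{k-1})$; the edge is said to be attached to that face. $A_k$ is a block annulus if the edges in its interior are attached to faces in the $4$-cycle class of $O(G_{k-1})$, and a ring annulus if they are attached to faces not in that class. By convention $A_1$ and $A_2$ are of the same type as $A_3$. *)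

theory Defs
  imports "HOL-Analysis.Analysis"
begin

section \<open>Finite undirected multigraphs\<close>

text \<open>
  Suppressing vertices of degree 2 may create loops and parallel edges, so the basic objects are
  undirected multigraphs; Barnette graphs are required to be simple.  A loop is an edge with a
  single end.
\<close>

record ('v, 'e) mgraph =
  verts :: "'v set"
  edges :: "'e set"
  ends  :: "'e \<Rightarrow> 'v set"

definition wf_mgraph :: "('v, 'e) mgraph \<Rightarrow> bool" where
  "wf_mgraph G \<longleftrightarrow> finite (verts G) \<and> finite (edges G) \<and>
     (\<forall>e\<in>edges G. ends G e \<subseteq> verts G \<and> card (ends G e) \<in> {1, 2})"

definition simple_graph :: "('v, 'e) mgraph \<Rightarrow> bool" where
  "simple_graph G \<longleftrightarrow> wf_mgraph G \<and> (\<forall>e\<in>edges G. card (ends G e) = 2) \<and> inj_on (ends G) (edges G)"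

definition degree :: "('v, 'e) mgraph \<Rightarrow> 'v \<Rightarrow> nat" where
  "degree G v = card {e \<in> edges G. v \<in> ends G e} + card {e \<in> edges G. ends G e = {v}}"

definition regular :: "nat \<Rightarrow> ('v, 'e) mgraph \<Rightarrow> bool" where
  "regular d G \<longleftrightarrow> (\<forall>v\<in>verts G. degree G v = d)"

definition bipartite :: "('v, 'e) mgraph \<Rightarrow> bool" where
  "bipartite G \<longleftrightarrow> (\<exists>A B. A \<union> B = verts G \<and> A \<inter> B = {} \<and>
     (\<forall>e\<in>edges G. \<exists>a\<in>A. \<exists>b\<in>B. ends G e = {a, b}))"

definition connected_graph :: "('v, 'e) mgraph \<Rightarrow> bool" where
  "connected_graph G \<longleftrightarrow> verts G \<noteq> {} \<and>
     (\<forall>u\<in>verts G. \<forall>v\<in>verts G. (u, v) \<in> {(a, b). \<exists>e\<in>edges G. ends G e = {a, b}}\<^sup>*)"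

definition induced :: "('v, 'e) mgraph \<Rightarrow> 'v set \<Rightarrow> ('v, 'e) mgraph" where
  "induced G X = \<lparr>verts = X, edges = {e \<in> edges G. ends G e \<subseteq> X}, ends = ends G\<rparr>"

definition del_edges :: "('v, 'e) mgraph \<Rightarrow> 'e set \<Rightarrow> ('v, 'e) mgraph" where
  "del_edges G F = \<lparr>verts = verts G, edges = edges G - F, ends = ends G\<rparr>"

definition k_connected :: "nat \<Rightarrow> ('v, 'e) mgraph \<Rightarrow> bool" where
  "k_connected k G \<longleftrightarrow> k < card (verts G) \<and>
     (\<forall>X \<subseteq> verts G. card X < k \<longrightarrow> connected_graph (induced G (verts G - X)))"

text \<open>A cycle is given by its set of edges; \<open>vertices_on G F\<close> is the set of vertices on it.\<close>

definition vertices_on :: "('v, 'e) mgraph \<Rightarrow> 'e set \<Rightarrow> 'v set" where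
  "vertices_on G F = (\<Union>e\<in>F. ends G e)"

definition is_cycle :: "('v, 'e) mgraph \<Rightarrow> 'e set \<Rightarrow> bool" where
  "is_cycle G F \<longleftrightarrow> F \<subseteq> edges G \<and>
     (\<exists>vs es. vs \<noteq> [] \<and> length vs = length es \<and> distinct vs \<and> distinct es \<and> set es = F \<and>
        (\<forall>i<length es. ends G (es ! i) = {vs ! i, vs ! (Suc i mod length vs)}))"

definition hamiltonian :: "('v, 'e) mgraph \<Rightarrow> bool" where
  "hamiltonian G \<longleftrightarrow> (\<exists>F. is_cycle G F \<and> vertices_on G F = verts G)"


section \<open>Plane embeddings and Barnette graphs\<close>

text \<open>
  The vertex \<open>v\<close> is drawn as the point \<open>pt v\<close> and the edge \<open>e\<close> as the point set \<open>cv e\<close>.  A simple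
  path is an arc if its two end points differ, and a simple closed curve (the case of a loop)
  otherwise.
\<close>

definition plane_embedding ::
    "('v, 'e) mgraph \<Rightarrow> ('v \<Rightarrow> complex) \<Rightarrow> ('e \<Rightarrow> complex set) \<Rightarrow> bool" where
  "plane_embedding G pt cv \<longleftrightarrow>
     inj_on pt (verts G) \<and>
     (\<forall>e\<in>edges G. \<exists>g. simple_path g \<and> path_image g = cv e \<and>
        {pathstart g, pathfinish g} = pt ` ends G e) \<and>
     (\<forall>e\<in>edges G. cv e \<inter> pt ` verts G = pt ` ends G e) \<and>
     (\<forall>e\<in>edges G. \<forall>f\<in>edges G. e \<noteq> f \<longrightarrow> cv e \<inter> cv f = pt ` (ends G e \<inter> ends G f))"

definition planar :: "('v, 'e) mgraph \<Rightarrow> bool" where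
  "planar G \<longleftrightarrow> (\<exists>pt cv. plane_embedding G pt cv)"

definition barnette :: "('v, 'e) mgraph \<Rightarrow> bool" where
  "barnette G \<longleftrightarrow> simple_graph G \<and> regular 3 G \<and> k_connected 3 G \<and> planar G \<and> bipartite G"

definition curve :: "('e \<Rightarrow> complex set) \<Rightarrow> 'e set \<Rightarrow> complex set" where
  "curve cv F = (\<Union>e\<in>F. cv e)"

definition faces ::
    "('v, 'e) mgraph \<Rightarrow> ('v \<Rightarrow> complex) \<Rightarrow> ('e \<Rightarrow> complex set) \<Rightarrow> complex set set" where
  "faces G pt cv = components (- (pt ` verts G \<union> curve cv (edges G)))"

definition boundary_edges ::
    "('v, 'e) mgraph \<Rightarrow> ('e \<Rightarrow> complex set) \<Rightarrow> complex set \<Rightarrow> 'e set" where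
  "boundary_edges G cv F = {e \<in> edges G. cv e \<subseteq> frontier F}"


section \<open>Suppressing vertices of degree 2\<close>

text \<open>
  A thread is (the edge set of) a maximal path whose internal vertices have degree 2; maximality
  means that its end vertices do not have degree 2.  The two end vertices may coincide, in which
  case the thread becomes a loop.
\<close>

definition is_thread :: "('v, 'e) mgraph \<Rightarrow> 'e set \<Rightarrow> bool" where
  "is_thread G T \<longleftrightarrow> T \<subseteq> edges G \<and>
     (\<exists>vs es. es \<noteq> [] \<and> length vs = Suc (length es) \<and> distinct es \<and> set es = T \<and>
        distinct (butlast vs) \<and> distinct (tl vs) \<and>
        (\<forall>i<length es. ends G (es ! i) = {vs ! i, vs ! Suc i}) \<and>
        (\<forall>i. 0 < i \<and> i < length es \<longrightarrow> degree G (vs ! i) = 2) \<and>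
        degree G (hd vs) \<noteq> 2 \<and> degree G (last vs) \<noteq> 2)"

text \<open>
  The edges of the suppressed graph are the threads.  A cycle all of whose vertices have degree 2
  contains no thread and so leaves no trace in \<open>suppress G\<close>; such cycles are recorded
  separately by \<open>closed_curves G\<close>.
\<close>

definition suppress :: "('v, 'e) mgraph \<Rightarrow> ('v, 'e set) mgraph" where
  "suppress G = \<lparr>verts = {v \<in> verts G. degree G v \<noteq> 2}, edges = {T. is_thread G T},
                 ends = (\<lambda>T. {v \<in> vertices_on G T. degree G v \<noteq> 2})\<rparr>"

definition closed_curves :: "('v, 'e) mgraph \<Rightarrow> 'e set set" where
  "closed_curves G = {F. is_cycle G F \<and> (\<forall>v\<in>vertices_on G F. degree G v = 2)}"

definition suppresses_to_two_barnette :: "('v, 'e) mgraph \<Rightarrow> bool" where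
  "suppresses_to_two_barnette H \<longleftrightarrow> closed_curves H = {} \<and>
     (\<exists>X Y. X \<union> Y = verts (suppress H) \<and> X \<inter> Y = {} \<and>
        (\<forall>T\<in>edges (suppress H). ends (suppress H) T \<subseteq> X \<or> ends (suppress H) T \<subseteq> Y) \<and>
        barnette (induced (suppress H) X) \<and> barnette (induced (suppress H) Y))"

definition suppresses_to_barnette_and_curve :: "('v, 'e) mgraph \<Rightarrow> bool" where
  "suppresses_to_barnette_and_curve H \<longleftrightarrow>
     (\<exists>F. closed_curves H = {F}) \<and> barnette (suppress H)"


section \<open>Annular decompositions\<close>

text \<open>
  The cycle \<open>C\<^sub>k\<close> is the edge set \<open>C k\<close>.  An edge joining \<open>C\<^sub>k\<^sub>-\<^sub>1\<close> to \<open>C\<^sub>k\<close> cannot cross either cycle,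
  so it runs through the interior of the annulus between them; hence the edges in the interior of
  the \<open>k\<close>-th annulus (\<open>k \<ge> 1\<close>) are exactly the following.
\<close>

definition annulus_edges :: "('v, 'e) mgraph \<Rightarrow> (nat \<Rightarrow> 'e set) \<Rightarrow> nat \<Rightarrow> 'e set" where
  "annulus_edges G C k = {e \<in> edges G. \<exists>u\<in>vertices_on G (C (k - 1)). \<exists>v\<in>vertices_on G (C k). ends G e = {u, v}}"

definition annular_embedding ::
    "('v, 'e) mgraph \<Rightarrow> ('v \<Rightarrow> complex) \<Rightarrow> ('e \<Rightarrow> complex set) \<Rightarrow> (nat \<Rightarrow> 'e set) \<Rightarrow> nat \<Rightarrow> bool" where
  "annular_embedding G pt cv C x \<longleftrightarrow>
     plane_embedding G pt cv \<and>
     (\<forall>k\<le>x. is_cycle G (C k)) \<and>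
     (\<forall>i\<le>x. \<forall>j\<le>x. i \<noteq> j \<longrightarrow> vertices_on G (C i) \<inter> vertices_on G (C j) = {}) \<and>
     (\<forall>k\<in>{1..x}. curve cv (C (k - 1)) \<subseteq> inside (curve cv (C k))) \<and>
     inside (curve cv (C 0)) \<in> faces G pt cv \<and>
     outside (curve cv (C x)) \<in> faces G pt cv \<and>
     verts G = (\<Union>k\<le>x. vertices_on G (C k)) \<and>
     edges G = (\<Union>k\<le>x. C k) \<union> (\<Union>k\<in>{1..x}. annulus_edges G C k)"

definition adb_graph ::
    "('v, 'e) mgraph \<Rightarrow> ('v \<Rightarrow> complex) \<Rightarrow> ('e \<Rightarrow> complex set) \<Rightarrow> (nat \<Rightarrow> 'e set) \<Rightarrow> nat \<Rightarrow> bool" where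
  "adb_graph G pt cv C x \<longleftrightarrow> barnette G \<and> annular_embedding G pt cv C x"

definition adb_ac_graph ::
    "('v, 'e) mgraph \<Rightarrow> ('v \<Rightarrow> complex) \<Rightarrow> ('e \<Rightarrow> complex set) \<Rightarrow> (nat \<Rightarrow> 'e set) \<Rightarrow> nat \<Rightarrow> bool" where
  "adb_ac_graph G pt cv C x \<longleftrightarrow> adb_graph G pt cv C x \<and> x > 2 \<and>
     (\<forall>k\<in>{1..x}. suppresses_to_two_barnette (del_edges G (annulus_edges G C k)) \<or>
                 suppresses_to_barnette_and_curve (del_edges G (annulus_edges G C k)))"


section \<open>Annular restrictions and the type of an annulus\<close>

definition inner_subgraph :: "('v, 'e) mgraph \<Rightarrow> (nat \<Rightarrow> 'e set) \<Rightarrow> nat \<Rightarrow> ('v, 'e) mgraph" where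
  "inner_subgraph G C k =
     \<lparr>verts = (\<Union>i\<le>k. vertices_on G (C i)),
      edges = (\<Union>i\<le>k. C i) \<union> (\<Union>i\<in>{1..k}. annulus_edges G C i),
      ends = ends G\<rparr>"

text \<open>An edge \<open>T\<close> of the restriction is a set of edges of \<open>G\<close>, drawn as \<open>curve cv T\<close>.\<close>

definition restriction :: "('v, 'e) mgraph \<Rightarrow> (nat \<Rightarrow> 'e set) \<Rightarrow> nat \<Rightarrow> ('v, 'e set) mgraph" where
  "restriction G C k = suppress (inner_subgraph G C k)"

definition outer_annulus_faces ::
    "('v, 'e) mgraph \<Rightarrow> ('v \<Rightarrow> complex) \<Rightarrow> ('e \<Rightarrow> complex set) \<Rightarrow> (nat \<Rightarrow> 'e set) \<Rightarrow> nat
       \<Rightarrow> complex set set" where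
  "outer_annulus_faces G pt cv C k =
     {F \<in> faces (restriction G C k) pt (curve cv).
        F \<subseteq> inside (curve cv (C k)) \<inter> outside (curve cv (C (k - 1)))}"

definition four_cycle_face ::
    "('v, 'e) mgraph \<Rightarrow> ('e \<Rightarrow> complex set) \<Rightarrow> (nat \<Rightarrow> 'e set) \<Rightarrow> nat \<Rightarrow> complex set \<Rightarrow> bool" where
  "four_cycle_face G cv C k F \<longleftrightarrow>
     is_cycle (restriction G C k) (boundary_edges (restriction G C k) (curve cv) F) \<and>
     card (boundary_edges (restriction G C k) (curve cv) F) = 4"

definition annulus_adjacent ::
    "('v, 'e) mgraph \<Rightarrow> ('e \<Rightarrow> complex set) \<Rightarrow> (nat \<Rightarrow> 'e set) \<Rightarrow> nat
       \<Rightarrow> complex set \<Rightarrow> complex set \<Rightarrow> bool" where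
  "annulus_adjacent G cv C k F F' \<longleftrightarrow>
     F \<noteq> F' \<and> (\<exists>e\<in>annulus_edges G C k. cv e \<subseteq> frontier F \<inter> frontier F')"

text \<open>
  The faces of the outer annulus form an even cycle under adjacency, so they split in exactly one
  way into two classes of pairwise non-adjacent faces.  For \<open>k \<ge> 2\<close> at most one of these classes
  consists of 4-cycles only, since some face has ends of edges of the annulus \<open>k - 1\<close> on its inner
  boundary and is therefore longer; so the predicate below determines \<open>D\<close>.  (For \<open>k = 1\<close> both classes may qualify,
  but the notion is only used for \<open>k \<ge> 2\<close>.)
\<close>

definition four_cycle_class ::
    "('v, 'e) mgraph \<Rightarrow> ('v \<Rightarrow> complex) \<Rightarrow> ('e \<Rightarrow> complex set) \<Rightarrow> (nat \<Rightarrow> 'e set) \<Rightarrow> nat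
       \<Rightarrow> complex set set \<Rightarrow> bool" where
  "four_cycle_class G pt cv C k D \<longleftrightarrow>
     D \<subseteq> outer_annulus_faces G pt cv C k \<and>
     (\<forall>F\<in>D. \<forall>F'\<in>D. \<not> annulus_adjacent G cv C k F F') \<and>
     (\<forall>F\<in>outer_annulus_faces G pt cv C k - D. \<forall>F'\<in>outer_annulus_faces G pt cv C k - D.
        \<not> annulus_adjacent G cv C k F F') \<and>
     (\<forall>F\<in>D. four_cycle_face G cv C k F)"

text \<open>
  The end \<open>v\<close> of \<open>e\<close> on \<open>C\<^sub>k\<^sub>-\<^sub>1\<close> is suppressed in the restriction, where it lies inside the
  edge \<open>T\<close> of the outer boundary; \<open>T\<close> lies on exactly one face of the outer annulus.
\<close>

definition attached ::
    "('v, 'e) mgraph \<Rightarrow> ('v \<Rightarrow> complex) \<Rightarrow> ('e \<Rightarrow> complex set) \<Rightarrow> (nat \<Rightarrow> 'e set) \<Rightarrow> nat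
       \<Rightarrow> 'e \<Rightarrow> complex set \<Rightarrow> bool" where
  "attached G pt cv C k e F \<longleftrightarrow>
     F \<in> outer_annulus_faces G pt cv C (k - 1) \<and>
     (\<exists>v \<in> ends G e \<inter> vertices_on G (C (k - 1)).
        \<exists>T \<in> boundary_edges (restriction G C (k - 1)) (curve cv) F.
          T \<subseteq> C (k - 1) \<and> v \<in> vertices_on G T)"

text \<open>The bound \<open>max k 3\<close> implements the convention that \<open>A\<^sub>1\<close> and \<open>A\<^sub>2\<close> have the type of \<open>A\<^sub>3\<close>.\<close>

definition block_annulus ::
    "('v, 'e) mgraph \<Rightarrow> ('v \<Rightarrow> complex) \<Rightarrow> ('e \<Rightarrow> complex set) \<Rightarrow> (nat \<Rightarrow> 'e set) \<Rightarrow> nat \<Rightarrow> bool" where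
  "block_annulus G pt cv C k \<longleftrightarrow>
     (let m = max k 3 in
      \<exists>D. four_cycle_class G pt cv C (m - 1) D \<and>
        (\<forall>e\<in>annulus_edges G C m. \<exists>F\<in>D. attached G pt cv C m e F))"

definition ring_annulus ::
    "('v, 'e) mgraph \<Rightarrow> ('v \<Rightarrow> complex) \<Rightarrow> ('e \<Rightarrow> complex set) \<Rightarrow> (nat \<Rightarrow> 'e set) \<Rightarrow> nat \<Rightarrow> bool" where
  "ring_annulus G pt cv C k \<longleftrightarrow>
     (let m = max k 3 in
      \<exists>D. four_cycle_class G pt cv C (m - 1) D \<and>
        (\<forall>e\<in>annulus_edges G C m.
           \<exists>F\<in>outer_annulus_faces G pt cv C (m - 1) - D. attached G pt cv C m e F))"

text \<open>The annuli \<open>A\<^sub>i, \<dots>, A\<^sub>j\<close> form a run of ring annuli between two block annuli (which makes the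
  run maximal).\<close>

definition enclosed_ring_run ::
    "('v, 'e) mgraph \<Rightarrow> ('v \<Rightarrow> complex) \<Rightarrow> ('e \<Rightarrow> complex set) \<Rightarrow> (nat \<Rightarrow> 'e set) \<Rightarrow> nat
       \<Rightarrow> nat \<Rightarrow> nat \<Rightarrow> bool" where
  "enclosed_ring_run G pt cv C x i j \<longleftrightarrow>
     1 < i \<and> i \<le> j \<and> j < x \<and> (\<forall>k\<in>{i..j}. ring_annulus G pt cv C k) \<and>
     block_annulus G pt cv C (i - 1) \<and> block_annulus G pt cv C (j + 1)"

end

theory Submission
  imports Defs
begin

text \<open>
  Call a vertex of \<open>C\<^sub>k\<close> outward or inward according to the side of \<open>C\<^sub>k\<close> on which its third edge lies.
  Bipartiteness of \<open>G\<close> and of the two graphs obtained by emptying an annulus forces every maximal run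
  of outward, or of inward, vertices on \<open>C\<^sub>k\<close> to have even length, so \<open>C\<^sub>k\<close> has a perfect matching whose
  edges have two ends of the same kind.

  By induction on \<open>k\<close> there is a cycle through all vertices of \<open>C\<^sub>0, \<dots>, C\<^sub>k\<close> that uses every edge of
  \<open>C\<^sub>k\<close> with an outward end.  For the step take the matching edges \<open>q\<close> of \<open>C\<^sub>k\<close> with outward ends and
  follow the annulus edges from the ends of \<open>q\<close> to two vertices of \<open>C\<^sub>k\<^sub>+\<^sub>1\<close>.  If these are joined by an
  edge \<open>f\<close> of \<open>C\<^sub>k\<^sub>+\<^sub>1\<close> for some \<open>q\<close>, replace this \<open>q\<close> by a detour along \<open>C\<^sub>k\<^sub>+\<^sub>1 - f\<close>.  Otherwise replace each
  \<open>q\<close> by a detour along the arc between them without inward vertices inside, which exists by planarity;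
  these arcs are disjoint, and they cover \<open>C\<^sub>k\<^sub>+\<^sub>1\<close> because the arc at an inward vertex avoids its matching
  edge.  (A ring annulus \<open>k + 2\<close> produces the first case, a block annulus the second.)
\<close>

section \<open>Cycles of a simple graph: periodic enumeration, propagation, edges at a
  vertex\<close>

text \<open>Indexing by all naturals with period \<open>n\<close> removes the wrap-around case from
  every later argument. Two-element ends exclude \<open>n = 1\<close>, and injectivity of
  \<open>ends G\<close> excludes \<open>n = 2\<close>.\<close>

lemma is_cycleE:
  assumes G: "simple_graph G" and F: "is_cycle G F"
  obtains w \<epsilon> and n :: nat where "3 \<le> n"
    and "\<And>i j. w i = w j \<longleftrightarrow> i mod n = j mod n"
    and "\<And>i j. \<epsilon> i = \<epsilon> j \<longleftrightarrow> i mod n = j mod n"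
    and "\<And>i. ends G (\<epsilon> i) = {w i, w (Suc i)}"
    and "F = range \<epsilon>" and "vertices_on G F = range w"
proof -
  obtain vs es where vs: "vs \<noteq> []" "length vs = length es" "distinct vs" "distinct es" "set es = F"
     and e: "\<And>i. i < length es \<Longrightarrow> ends G (es ! i) = {vs ! i, vs ! (Suc i mod length vs)}"
    and FG: "F \<subseteq> edges G"
    using F unfolding is_cycle_def by blast
  define n where "n = length vs"
  have n0: "n > 0" using vs n_def by auto
  define w where "w = (\<lambda>i. vs ! (i mod n))"
  define \<epsilon> where "\<epsilon> = (\<lambda>i. es ! (i mod n))"
  have w: "w i = w j \<longleftrightarrow> i mod n = j mod n" for i j
    using vs n0 by (simp add: w_def n_def nth_eq_iff_index_eq)
  have \<epsilon>: "\<epsilon> i = \<epsilon> j \<longleftrightarrow> i mod n = j mod n" for i j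
    using vs n0 by (simp add: \<epsilon>_def n_def nth_eq_iff_index_eq)
  have ends: "ends G (\<epsilon> i) = {w i, w (Suc i)}" for i
    using e[of "i mod n"] n0 vs by (simp add: w_def \<epsilon>_def n_def mod_Suc_eq)
  have "set es = range \<epsilon>"
  proof
    show "set es \<subseteq> range \<epsilon>"
    proof
      fix e assume "e \<in> set es"
      then obtain i where "i < n" "e = es ! i" using vs n_def by (metis in_set_conv_nth)
      then have "e = \<epsilon> i" by (simp add: \<epsilon>_def)
      then show "e \<in> range \<epsilon>" by blast
    qed
    show "range \<epsilon> \<subseteq> set es" using n0 vs by (auto simp: \<epsilon>_def n_def)
  qed
  then have F_eq: "F = range \<epsilon>" using vs by simp
  have V: "vertices_on G F = range w"
  proof -
    have "vertices_on G F = (\<Union>i. {w i, w (Suc i)})"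
      by (simp add: vertices_on_def F_eq ends)
    also have "\<dots> = range w" by auto
    finally show ?thesis .
  qed
  have c2: "card (ends G (\<epsilon> i)) = 2" for i
    using G FG F_eq unfolding simple_graph_def by auto
  have "n \<noteq> 1"
  proof
    assume "n = 1"
    then have "w (Suc 0) = w 0" using w by simp
    then show False using c2[of 0] ends[of 0] by simp
  qed
  moreover have "n \<noteq> 2"
  proof
    assume n2: "n = 2"
    then have "w (Suc (Suc 0)) = w 0" by (simp add: w)
    then have "ends G (\<epsilon> 0) = ends G (\<epsilon> (Suc 0))" using ends[of 0] ends[of "Suc 0"] by auto
    moreover have "inj_on (ends G) (edges G)" using G unfolding simple_graph_def by auto
    ultimately have "\<epsilon> 0 = \<epsilon> (Suc 0)" using FG F_eq unfolding inj_on_def by blast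
    then show False using n2 \<epsilon> by simp
  qed
  ultimately have "n \<ge> 3" using n0 by linarith
  with that w \<epsilon> ends F_eq V show thesis by blast
qed

text \<open>Induction around a cycle: membership in \<open>S\<close> passes along each edge, so one
  vertex in \<open>S\<close> suffices. It serves for agreement of colourings and for covering a
  cycle by arcs.\<close>

lemma cycle_closed:
  assumes "simple_graph G" "is_cycle G F"
    and "S \<inter> vertices_on G F \<noteq> {}"
    and S: "\<And>e. e \<in> F \<Longrightarrow> ends G e \<inter> S \<noteq> {} \<Longrightarrow> ends G e \<subseteq> S"
  shows "vertices_on G F \<subseteq> S"
proof -
  from assms(1,2) obtain w \<epsilon> and n :: nat where n: "3 \<le> n"
    and w: "\<And>i j. w i = w j \<longleftrightarrow> i mod n = j mod n"
    and e: "\<And>i. ends G (\<epsilon> i) = {w i, w (Suc i)}"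
    and F: "F = range \<epsilon>" and V: "vertices_on G F = range w"
    by (rule is_cycleE) blast
  from assms(3) V obtain i where i: "w i \<in> S" by auto
  have step: "w (i + m) \<in> S" for m
  proof (induction m)
    case (Suc m)
    then show ?case using S[of "\<epsilon> (i + m)"] e F by auto
  qed (use i in simp)
  have "w j \<in> S" for j
  proof -
    \<comment> \<open>Only forward steps are available. Since \<open>m\<close> is congruent to -1
      modulo \<open>n\<close>, going \<open>j + m * i\<close> steps on from \<open>i\<close> reaches
      the residue of \<open>j\<close>.\<close>
    obtain m where m: "n = Suc m" using n by (cases n) auto
    then have "i + (j + m * i) = j + n * i" by simp
    then have "(i + (j + m * i)) mod n = j mod n" by (simp only: mod_mult_self2)
    then have "w j = w (i + (j + m * i))" by (simp only: w)
    then show ?thesis using step by simp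
  qed
  then show ?thesis using V by auto
qed

lemma cycle_incident:
  assumes "simple_graph G" "is_cycle G F" "v \<in> vertices_on G F"
  shows "card {e \<in> F. v \<in> ends G e} = 2"
proof -
  from assms(1,2) obtain w \<epsilon> and n :: nat where n: "3 \<le> n"
    and w: "\<And>i j. w i = w j \<longleftrightarrow> i mod n = j mod n"
    and \<epsilon>: "\<And>i j. \<epsilon> i = \<epsilon> j \<longleftrightarrow> i mod n = j mod n"
    and e: "\<And>i. ends G (\<epsilon> i) = {w i, w (Suc i)}"
    and F: "F = range \<epsilon>" and V: "vertices_on G F = range w"
    by (rule is_cycleE) blast
  obtain i0 where "v = w i0" using assms(3) V by auto
  \<comment> \<open>Adding \<open>n - 1\<close> instead of subtracting 1 gives a predecessor index
    even for \<open>i0 = 0\<close>.\<close>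
  then have v: "v = w (Suc i)" if "i = i0 + n - 1" for i using that w n by simp
  define i where "i = i0 + n - 1"
  have v: "v = w (Suc i)" using v i_def by simp
  have "{e \<in> F. v \<in> ends G e} = {\<epsilon> i, \<epsilon> (Suc i)}"
  proof
    show "{e \<in> F. v \<in> ends G e} \<subseteq> {\<epsilon> i, \<epsilon> (Suc i)}"
    proof
      fix f assume "f \<in> {e \<in> F. v \<in> ends G e}"
      then obtain j where j: "f = \<epsilon> j" "w (Suc i) = w j \<or> w (Suc i) = w (Suc j)"
        using F e v by auto
      then have "Suc i mod n = j mod n \<or> i mod n = j mod n"
        using w n by (auto simp: mod_Suc split: if_splits)
      then show "f \<in> {\<epsilon> i, \<epsilon> (Suc i)}" using j \<epsilon> by auto
    qed
  qed (use F e v in auto)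
  moreover have "\<epsilon> i \<noteq> \<epsilon> (Suc i)" using \<epsilon> n by (auto simp: mod_Suc)
  ultimately show ?thesis by simp
qed

section \<open>Paths\<close>

text \<open>Vertices and edges are listed side by side, so that a path offers both an order of
  traversal and an edge set for surgery on cycles. The recursive form suits induction;
  \<open>gpath_nth\<close> is the indexwise form.\<close>

fun gpath :: "('v, 'e) mgraph \<Rightarrow> 'v list \<Rightarrow> 'e list \<Rightarrow> bool" where
  "gpath G [] es \<longleftrightarrow> False"
| "gpath G [v] es \<longleftrightarrow> es = []"
| "gpath G (u # v # vs) [] \<longleftrightarrow> False"
| "gpath G (u # v # vs) (e # es) \<longleftrightarrow>
     e \<in> edges G \<and> ends G e = {u, v} \<and> u \<notin> set (v # vs) \<and> gpath G (v # vs) es"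

lemma gpath_nonempty: "gpath G vs es \<Longrightarrow> vs \<noteq> []"
  by (cases vs) auto

lemma gpath_distinct: "gpath G vs es \<Longrightarrow> distinct vs"
  by (induction G vs es rule: gpath.induct) auto

lemma gpath_length: "gpath G vs es \<Longrightarrow> length vs = Suc (length es)"
  by (induction G vs es rule: gpath.induct) auto

lemma gpath_edges: "gpath G vs es \<Longrightarrow> set es \<subseteq> edges G"
  by (induction G vs es rule: gpath.induct) auto

lemma gpath_vertices_on: "gpath G vs es \<Longrightarrow> vertices_on G (set es) \<subseteq> set vs"
  by (induction G vs es rule: gpath.induct) (auto simp: vertices_on_def)

lemma gpath_vertices_on_eq: "gpath G vs es \<Longrightarrow> es \<noteq> [] \<Longrightarrow> vertices_on G (set es) = set vs"
proof (induction G vs es rule: gpath.induct)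
  case (4 G u v vs e es)
  show ?case
  proof (cases "es = []")
    case True
    then have "vs = []" using 4 by (cases vs) auto
    then show ?thesis using 4 True by (auto simp: vertices_on_def)
  next
    case False
    then show ?thesis using 4 by (auto simp: vertices_on_def)
  qed
qed auto

lemma gpath_distinct_edges: "gpath G vs es \<Longrightarrow> distinct es"
proof (induction G vs es rule: gpath.induct)
  case (4 G u v vs e es)
  then have "vertices_on G (set es) \<subseteq> set (v # vs)" using gpath_vertices_on[of G "v # vs" es] by simp
  then have "e \<notin> set es" using 4 by (auto simp: vertices_on_def)
  then show ?case using 4 by auto
qed auto

lemma gpath_nth:
  "gpath G vs es \<longleftrightarrow> length vs = Suc (length es) \<and> distinct vs \<and> set es \<subseteq> edges G \<and>
     (\<forall>i<length es. ends G (es ! i) = {vs ! i, vs ! Suc i})"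
proof (induction G vs es rule: gpath.induct)
  case (4 G u v vs e es)
  then show ?case by (auto simp: All_less_Suc2)
qed auto

lemma gpath_append:
  "gpath G (xs @ [v]) es \<Longrightarrow> gpath G (v # ys) es' \<Longrightarrow> set xs \<inter> set (v # ys) = {} \<Longrightarrow>
     gpath G (xs @ v # ys) (es @ es')"
proof (induction xs arbitrary: es)
  case (Cons a xs)
  then show ?case by (cases xs; cases es) auto
qed auto

lemma gpath_split:
  "gpath G (xs @ v # ys) es \<Longrightarrow>
     \<exists>es1 es2. es = es1 @ es2 \<and> gpath G (xs @ [v]) es1 \<and> gpath G (v # ys) es2"
proof (induction xs arbitrary: es)
  case (Cons a xs)
  then obtain e es0 where es: "es = e # es0" by (cases xs; cases es) auto
  then have "gpath G (xs @ v # ys) es0" using Cons.prems by (cases xs) auto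
  then obtain es1 es2 where 1: "es0 = es1 @ es2" "gpath G (xs @ [v]) es1" "gpath G (v # ys) es2"
    using Cons.IH by blast
  have "gpath G (a # xs @ [v]) (e # es1)" using Cons.prems es 1 by (cases xs) auto
  then show ?case using es 1 by (metis append_Cons)
qed auto

lemma gpath_rev: "gpath G vs es \<Longrightarrow> gpath G (rev vs) (rev es)"
proof (induction G vs es rule: gpath.induct)
  case (4 G u v vs e es)
  then have "gpath G (rev vs @ [v]) (rev es)" by simp
  moreover have "gpath G [v, u] [e]" using 4 by auto
  ultimately have "gpath G (rev vs @ v # [u]) (rev es @ [e])"
    using gpath_append[of G "rev vs" v "rev es" "[u]" "[e]"] 4 gpath_distinct[of G "v # vs" es] by auto
  then show ?case by simp
qed auto

text \<open>The path edges before and after \<open>v\<close> are distinct. As a cycle has only two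
  edges at each vertex, a path running along a cycle contains all cycle edges at its interior
  vertices.\<close>

lemma gpath_interior:
  assumes "gpath G vs es" "v \<in> set vs" "v \<noteq> hd vs" "v \<noteq> last vs"
  shows "2 \<le> card {e \<in> set es. v \<in> ends G e}"
proof -
  obtain i where i: "i < length vs" "v = vs ! i" using assms(2) by (metis in_set_conv_nth)
  have L: "length vs = Suc (length es)" and "vs \<noteq> []"
    using assms(1) by (auto simp: gpath_length gpath_nonempty)
  have "i \<noteq> 0" using i assms(3) \<open>vs \<noteq> []\<close> by (metis hd_conv_nth)
  then obtain j where j: "i = Suc j" by (cases i) auto
  have "i \<noteq> length es" using i assms(4) L \<open>vs \<noteq> []\<close> by (metis last_conv_nth diff_Suc_1)
  then have l: "i < length es" using i L by simp
  have e: "\<And>i. i < length es \<Longrightarrow> ends G (es ! i) = {vs ! i, vs ! Suc i}"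
    using assms(1) by (simp add: gpath_nth)
  have "{es ! j, es ! i} \<subseteq> {e \<in> set es. v \<in> ends G e}" using e[of j] e[of i] l j i by auto
  moreover have "es ! j \<noteq> es ! i"
    using gpath_distinct_edges[OF assms(1)] l j by (simp add: nth_eq_iff_index_eq)
  ultimately show ?thesis using card_mono[of "{e \<in> set es. v \<in> ends G e}" "{es ! j, es ! i}"] by simp
qed

lemma cycle_path:
  assumes G: "simple_graph G" and F: "is_cycle G F" and "e \<in> F"
  obtains vs es where "gpath G vs es" "set es = F - {e}" "ends G e = {hd vs, last vs}"
    "set vs = vertices_on G F" "3 \<le> length vs"
proof -
  from assms(1,2) obtain w \<epsilon> and n :: nat where n: "3 \<le> n"
    and w: "\<And>i j. w i = w j \<longleftrightarrow> i mod n = j mod n"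
    and \<epsilon>: "\<And>i j. \<epsilon> i = \<epsilon> j \<longleftrightarrow> i mod n = j mod n"
    and e: "\<And>i. ends G (\<epsilon> i) = {w i, w (Suc i)}"
    and F_eq: "F = range \<epsilon>" and V: "vertices_on G F = range w"
    by (rule is_cycleE) blast
  obtain i0 where i0: "e = \<epsilon> i0" using \<open>e \<in> F\<close> F_eq by auto
  \<comment> \<open>The path starts just after \<open>e\<close>, at index \<open>Suc i0\<close>, and
    makes a full turn: \<open>n\<close> vertices but \<open>n - 1\<close> edges, the missing one
    being \<open>e\<close>.\<close>
  define vs where "vs = map (\<lambda>k. w (Suc i0 + k)) [0..<n]"
  define es where "es = map (\<lambda>k. \<epsilon> (Suc i0 + k)) [0..<n - 1]"
  have inj: "a = b" if "(Suc i0 + a) mod n = (Suc i0 + b) mod n" "a < n" "b < n" for a b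
    using that
  proof (induction a b rule: linorder_wlog)
    case (le a b)
    then have "n dvd (Suc i0 + b) - (Suc i0 + a)"
      by (metis mod_eq_dvd_iff_nat add_left_mono)
    then have "n dvd b - a" by simp
    then show ?case using le by (auto dest: dvd_imp_le)
  next
    case (sym a b)
    then show ?case by simp
  qed
  have surj: "\<exists>k<n. j mod n = (Suc i0 + k) mod n" for j
  proof -
    obtain m where m: "n = Suc m" using n by (cases n) auto
    then have "Suc i0 + (j + m * Suc i0) = j + n * Suc i0" by simp
    then have "(Suc i0 + (j + m * Suc i0) mod n) mod n = j mod n"
      by (simp only: mod_add_right_eq mod_mult_self2)
    moreover have "(j + m * Suc i0) mod n < n" using n by simp
    ultimately show ?thesis by metis
  qed
  have "inj_on (\<lambda>k. w (Suc i0 + k)) (set [0..<n])"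
  proof (rule inj_onI)
    fix a b assume "a \<in> set [0..<n]" "b \<in> set [0..<n]" and eq: "w (Suc i0 + a) = w (Suc i0 + b)"
    then have "a < n" "b < n" by simp_all
    moreover have "(Suc i0 + a) mod n = (Suc i0 + b) mod n" using eq by (simp only: w)
    ultimately show "a = b" using inj by blast
  qed
  then have "distinct vs" unfolding vs_def by (simp add: distinct_map)
  moreover have "set es \<subseteq> edges G" using F F_eq unfolding es_def is_cycle_def by auto
  ultimately have "gpath G vs es"
    unfolding gpath_nth using n e by (auto simp: vs_def es_def)
  moreover have "set es = F - {e}"
  proof
    show "set es \<subseteq> F - {e}"
    proof
      fix f assume "f \<in> set es"
      then obtain k where k: "k < n - 1" "f = \<epsilon> (Suc i0 + k)" by (auto simp: es_def)
      have "\<epsilon> (Suc i0 + k) \<noteq> \<epsilon> i0"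
      proof
        assume "\<epsilon> (Suc i0 + k) = \<epsilon> i0"
        then have "(Suc i0 + k) mod n = (Suc i0 + (n - 1)) mod n" using \<epsilon> n by simp
        then show False using inj[of k "n - 1"] k by simp
      qed
      then show "f \<in> F - {e}" using k F_eq i0 by auto
    qed
    show "F - {e} \<subseteq> set es"
    proof
      fix f assume f: "f \<in> F - {e}"
      then obtain j where j: "f = \<epsilon> j" using F_eq by auto
      obtain k where k: "k < n" "j mod n = (Suc i0 + k) mod n" using surj by blast
      then have fk: "f = \<epsilon> (Suc i0 + k)" using j \<epsilon> by simp
      have "k \<noteq> n - 1"
      proof
        assume "k = n - 1"
        then have "\<epsilon> (Suc i0 + k) = \<epsilon> i0" using \<epsilon> n by simp
        then show False using fk f i0 by simp
      qed
      then show "f \<in> set es" using k fk by (auto simp: es_def)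
    qed
  qed
  moreover have "ends G e = {hd vs, last vs}"
  proof -
    have "hd vs = w (Suc i0)" using n by (simp add: vs_def hd_map)
    moreover have "last vs = w (Suc i0 + (n - 1))" using n by (simp add: vs_def last_map)
    moreover have "w (Suc i0 + (n - 1)) = w i0" using n by (simp add: w)
    ultimately show ?thesis using e i0 by auto
  qed
  moreover have "set vs = vertices_on G F"
  proof -
    have "w j \<in> set vs" for j
    proof -
      obtain k where k: "k < n" "j mod n = (Suc i0 + k) mod n" using surj by blast
      then have "w j = w (Suc i0 + k)" using w by simp
      then show ?thesis using k by (auto simp: vs_def)
    qed
    then show ?thesis using V by (auto simp: vs_def)
  qed
  moreover have "3 \<le> length vs" using n by (simp add: vs_def)
  ultimately show thesis using that by blast
qed

section \<open>Surgery on cycles: closing a path, replacing an edge, splitting into two arcs\<close>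

lemma gpath_closing_cycle:
  assumes p: "gpath G vs es" and "e \<in> edges G" "e \<notin> set es" "ends G e = {hd vs, last vs}"
  shows "is_cycle G (insert e (set es))"
proof -
  note n = p[unfolded gpath_nth] gpath_nonempty[OF p]
  have "ends G ((es @ [e]) ! i) = {vs ! i, vs ! (Suc i mod length vs)}" if "i < length (es @ [e])" for i
  proof (cases "i < length es")
    case True
    then show ?thesis using n by (simp add: nth_append)
  next
    case False
    then have "i = length es" using that by simp
    then show ?thesis using n assms(4) by (auto simp: hd_conv_nth last_conv_nth)
  qed
  moreover have "distinct (es @ [e])" using gpath_distinct_edges[OF p] assms by simp
  moreover have "length vs = length (es @ [e])" using n by simp
  moreover have "set (es @ [e]) = insert e (set es)" by simp
  ultimately show ?thesis unfolding is_cycle_def using n assms(2)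
    by (intro conjI exI[of _ vs] exI[of _ "es @ [e]"]) auto
qed

text \<open>Opening the cycle at \<open>e\<close> gives a path between the ends of the new path, and
  the two paths meet only there. With at least two edges the new path has an interior vertex, which
  makes its last edge different from all edges of \<open>F\<close>.\<close>

lemma cycle_replace_edge:
  assumes G: "simple_graph G" and F: "is_cycle G F" and e: "e \<in> F"
    and p: "gpath G vs es" and ends: "ends G e = {hd vs, last vs}"
    and int: "set vs \<inter> vertices_on G F = ends G e" and len: "2 \<le> length es"
  shows "is_cycle G (F - {e} \<union> set es)"
    and "vertices_on G (F - {e} \<union> set es) = vertices_on G F \<union> set vs"
proof -
  obtain us fs where q: "gpath G us fs" "set fs = F - {e}" "ends G e = {hd us, last us}"
      "set us = vertices_on G F" "3 \<le> length us"
    using cycle_path[OF G F e] by blast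
  have c2: "card (ends G e) = 2" using G F e unfolding simple_graph_def is_cycle_def by auto
  \<comment> \<open>The new path is reversed if necessary, so that it starts where the opened cycle
    ends.\<close>
  obtain xs ys where xs: "gpath G xs ys" "set ys = set es" "set xs = set vs" "hd xs = last us" "last xs = hd us"
    "length ys = length es"
  proof (cases "hd vs = last us")
    case True
    then have "last vs = hd us" using ends q(3) c2 by (auto simp: doubleton_eq_iff)
    then show thesis using True p that by blast
  next
    case False
    then have "last vs = last us" "hd vs = hd us" using ends q(3) c2 by (auto simp: doubleton_eq_iff)
    moreover have "hd (rev vs) = last vs" "last (rev vs) = hd vs"
      using gpath_nonempty[OF p] by (auto simp: hd_rev last_rev)
    ultimately show thesis using that[of "rev vs" "rev es"] gpath_rev[OF p] by auto
  qed
  obtain ys' f where ys: "ys = ys' @ [f]" using xs(6) len by (cases ys rule: rev_exhaust) auto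
  have lxs: "length xs = Suc (length ys)" by (rule gpath_length[OF xs(1)])
  then obtain a zs where "xs = a # zs" by (cases xs) auto
  moreover obtain zs' b c where "zs = zs' @ [b, c]"
  proof -
    have "2 \<le> length zs" using lxs \<open>xs = a # zs\<close> xs(6) len by simp
    then obtain zs1 c where 1: "zs = zs1 @ [c]" by (cases zs rule: rev_exhaust) auto
    then obtain zs2 b where "zs1 = zs2 @ [b]" using \<open>2 \<le> length zs\<close> by (cases zs1 rule: rev_exhaust) auto
    then show thesis using 1 that by simp
  qed
  ultimately have xs_eq: "xs = (a # zs') @ b # [c]" by simp
  \<comment> \<open>The last edge of the new path is split off: the remainder extends the opened
    cycle to one long path, and this edge closes it.\<close>
  obtain e1 e2 where sp: "ys = e1 @ e2" "gpath G ((a # zs') @ [b]) e1" "gpath G [b, c] e2"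
    using gpath_split[OF xs(1)[unfolded xs_eq]] by blast
  then obtain f' where f': "e2 = [f']" "f' \<in> edges G" "ends G f' = {b, c}" "b \<noteq> c"
    by (cases e2) auto
  have a: "a = last us" "c = hd us" using xs xs_eq by auto
  obtain us' where us: "us = us' @ [a]" using a q(5) by (cases us rule: rev_exhaust) auto
  have dx: "distinct xs" by (rule gpath_distinct[OF xs(1)])
  have du: "distinct us" by (rule gpath_distinct[OF q(1)])
  have meet: "set xs \<inter> set us = {a, c}" using int q xs a by auto
  have app: "gpath G (us' @ a # (zs' @ [b])) (fs @ e1)"
  proof (rule gpath_append)
    show "set us' \<inter> set (a # zs' @ [b]) = {}"
    proof -
      have "z = a \<or> z = c" if "z \<in> set us'" "z \<in> set xs" for z using that meet us by auto
      moreover have "a \<notin> set us'" "c \<notin> set (a # zs' @ [b])" "set (a # zs' @ [b]) \<subseteq> set xs"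
        using du us dx xs_eq by auto
      ultimately show ?thesis by blast
    qed
  qed (use q(1) us sp(2) in auto)
  have "f' \<notin> set (fs @ e1)"
  proof
    assume "f' \<in> set (fs @ e1)"
    then have "f' \<in> set fs \<or> f' \<in> set e1" by auto
    moreover have "f' \<notin> set e1"
      using gpath_distinct_edges[OF xs(1)] sp f' by auto
    moreover have "f' \<notin> set fs"
    proof
      assume "f' \<in> set fs"
      then have "b \<in> set us" using gpath_vertices_on[OF q(1)] f' by (auto simp: vertices_on_def)
      then show False using meet dx xs_eq by auto
    qed
    ultimately show False by blast
  qed
  moreover have "ends G f' = {hd (us' @ a # zs' @ [b]), last (us' @ a # zs' @ [b])}"
  proof -
    have "hd (us' @ a # zs' @ [b]) = hd us" using us by (cases us') auto
    then show ?thesis using f' a by auto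
  qed
  ultimately have "is_cycle G (insert f' (set (fs @ e1)))"
    using gpath_closing_cycle[OF app] f' by simp
  moreover have eq: "insert f' (set (fs @ e1)) = F - {e} \<union> set es" using q sp f' xs by auto
  ultimately show "is_cycle G (F - {e} \<union> set es)" by simp
  have "fs \<noteq> []" using q(1,5) gpath_length[OF q(1)] by auto
  then have "vertices_on G (set fs) = set us" using gpath_vertices_on_eq q(1) by blast
  moreover have "vertices_on G (set es) = set vs" using gpath_vertices_on_eq[OF p] len by fastforce
  ultimately show "vertices_on G (F - {e} \<union> set es) = vertices_on G F \<union> set vs"
    using q by (auto simp: vertices_on_def)
qed

text \<open>Opened at an edge \<open>e\<close> incident with \<open>p\<close>, the cycle is a path
  from \<open>p\<close> through \<open>q\<close>. Its part up to \<open>q\<close> is one arc; the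
  other consists of \<open>e\<close> and the rest of the path.\<close>

lemma cycle_split:
  assumes G: "simple_graph G" and F: "is_cycle G F"
    and "p \<in> vertices_on G F" "q \<in> vertices_on G F" "p \<noteq> q"
  obtains vs1 es1 vs2 es2 where "gpath G vs1 es1" "gpath G vs2 es2"
    "hd vs1 = p" "last vs1 = q" "hd vs2 = p" "last vs2 = q"
    "set es1 \<union> set es2 = F" "set es1 \<inter> set es2 = {}"
    "set vs1 \<inter> set vs2 = {p, q}" "set vs1 \<union> set vs2 = vertices_on G F"
proof -
  obtain e where e: "e \<in> F" "p \<in> ends G e" using assms(3) by (auto simp: vertices_on_def)
  obtain us0 fs0 where q0: "gpath G us0 fs0" "set fs0 = F - {e}" "ends G e = {hd us0, last us0}"
      "set us0 = vertices_on G F" "3 \<le> length us0"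
    using cycle_path[OF G F e(1)] by blast
  obtain us fs where q: "gpath G us fs" "set fs = F - {e}" "ends G e = {hd us, last us}"
      "set us = vertices_on G F" "3 \<le> length us" "hd us = p"
  proof (cases "hd us0 = p")
    case True then show thesis using q0 that by blast
  next
    case False
    then have "hd (rev us0) = p" using e q0 by (auto simp: hd_rev)
    then show thesis using that[of "rev us0" "rev fs0"] gpath_rev[OF q0(1)] q0
        gpath_nonempty[OF q0(1)] by (auto simp: hd_rev last_rev)
  qed
  obtain xs ys where us: "us = xs @ q # ys" using assms(4) q(4) by (metis split_list)
  obtain e1 e2 where sp: "fs = e1 @ e2" "gpath G (xs @ [q]) e1" "gpath G (q # ys) e2"
    using gpath_split[OF q(1)[unfolded us]] by blast
  have "xs \<noteq> []" using us q(6) assms(5) by auto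
  then obtain xs' where xs: "xs = p # xs'" using us q(6) by (cases xs) auto
  have d: "distinct us" by (rule gpath_distinct[OF q(1)])
  have eG: "e \<in> edges G" using F e unfolding is_cycle_def by auto
  \<comment> \<open>The second arc leaves \<open>p\<close> through \<open>e\<close>, arrives at the
    far end \<open>b\<close> of the path and follows it backwards to \<open>q\<close>.\<close>
  define b where "b = last (q # ys)"
  have b: "ends G e = {p, b}" using q(3,6) us b_def by simp
  obtain zs where zs: "rev (q # ys) = b # zs"
    by (metis b_def hd_rev list.collapse rev_is_Nil_conv list.distinct(1))
  have r: "gpath G (b # zs) (rev e2)" using gpath_rev[OF sp(3)] by (simp only: zs)
  have pn: "p \<notin> set (q # ys)" using d us xs by auto
  then have pz: "p \<notin> set (b # zs)" by (metis set_rev zs)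
  have g2: "gpath G (p # b # zs) (e # rev e2)" using r eG b pz by simp
  have sz: "set (b # zs) = set (q # ys)" by (metis set_rev zs)
  show thesis
  proof (rule that[OF sp(2) g2])
    show "hd (xs @ [q]) = p" using xs by simp
    show "last (p # b # zs) = q" 
    proof -
      have "last (rev (q # ys)) = q" by simp
      then show ?thesis by (simp only: zs last.simps list.distinct if_False)
    qed
    show "set e1 \<union> set (e # rev e2) = F" using q sp e by auto
    show "set e1 \<inter> set (e # rev e2) = {}" using gpath_distinct_edges[OF q(1)] sp q(2) by auto
    show "set (xs @ [q]) \<inter> set (p # b # zs) = {p, q}"
      using sz d us xs by auto
    show "set (xs @ [q]) \<union> set (p # b # zs) = vertices_on G F"
      using sz q(4) us xs by auto
  qed simp_all
qed

section \<open>Curves of paths and cycles\<close>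

text \<open>The chord \<open>c\<close> cuts the interior of the closed curve into two regions, each
  bounded by \<open>c\<close> and one of the two arcs. A connected set avoiding \<open>c\<close>
  stays in one region, so its closure cannot reach both arcs away from \<open>a\<close> and
  \<open>b\<close>.\<close>

lemma theta_crossing:
  fixes c1 c2 c :: "real \<Rightarrow> complex"
  assumes "arc c1" "pathstart c1 = a" "pathfinish c1 = b"
    and "arc c2" "pathstart c2 = a" "pathfinish c2 = b"
    and "arc c" "pathstart c = a" "pathfinish c = b"
    and c1c2: "path_image c1 \<inter> path_image c2 = {a, b}"
    and c1c: "path_image c1 \<inter> path_image c = {a, b}"
    and c2c: "path_image c2 \<inter> path_image c = {a, b}"
    and ne: "path_image c \<inter> inside (path_image c1 \<union> path_image c2) \<noteq> {}"
    and K: "connected K" "K \<subseteq> inside (path_image c1 \<union> path_image c2)" "K \<inter> path_image c = {}"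
    and z1: "z1 \<in> closure K" "z1 \<in> path_image c1 - {a, b}"
    and z2: "z2 \<in> closure K" "z2 \<in> path_image c2 - {a, b}"
  shows False
proof -
  let ?J = "path_image c1 \<union> path_image c2"
  let ?I1 = "inside (path_image c1 \<union> path_image c)"
  let ?I2 = "inside (path_image c2 \<union> path_image c)"
  have "a \<noteq> b" using assms(1-3) arc_distinct_ends by metis
  then obtain disj: "?I1 \<inter> ?I2 = {}"
    and un: "?I1 \<union> ?I2 \<union> (path_image c - {a, b}) = inside ?J"
    using split_inside_simple_closed_curve[OF arc_imp_simple_path[OF assms(1)] assms(2,3)
        arc_imp_simple_path[OF assms(4)] assms(5,6) arc_imp_simple_path[OF assms(7)] assms(8,9)
        _ c1c2 c1c c2c ne]
    by blast
  \<comment> \<open>The Jordan curve theorem for the two closed curves formed by \<open>c\<close>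
    and one outer arc \<open>d\<close>.\<close>
  have J: "open (inside (path_image d \<union> path_image c)) \<and>
      frontier (inside (path_image d \<union> path_image c)) = path_image d \<union> path_image c"
    if "arc d" "pathstart d = a" "pathfinish d = b" "path_image d \<inter> path_image c = {a, b}" for d
  proof -
    have "simple_path (d +++ reversepath c)"
      using that assms(7-9) by (intro simple_path_join_loop) (auto intro: arc_reversepath)
    moreover have "path_image (d +++ reversepath c) = path_image d \<union> path_image c"
      using that assms(7-9) by (simp add: path_image_join)
    ultimately show ?thesis
      using that assms(7-9) Jordan_inside_outside[of "d +++ reversepath c"] by simp
  qed
  have o: "open ?I1" "open ?I2" and f: "frontier ?I1 = path_image c1 \<union> path_image c"
      "frontier ?I2 = path_image c2 \<union> path_image c"
    using J assms by auto
  have "K \<subseteq> ?I1 \<union> ?I2" using K un by blast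
  then have "?I1 \<inter> K = {} \<or> ?I2 \<inter> K = {}"
    using connectedD[OF K(1) o] disj by blast
  then consider "K \<subseteq> ?I1" | "K \<subseteq> ?I2" using \<open>K \<subseteq> ?I1 \<union> ?I2\<close> by blast
  then show False
  proof cases
    case 1
    \<comment> \<open>A limit point of \<open>K\<close> lies in the region or on its frontier. Since
      \<open>z2\<close> is on neither \<open>c1\<close> nor \<open>c\<close>, it would be interior,
      although it lies on the outer curve.\<close>
    then have "z2 \<in> ?I1 \<union> frontier ?I1" using closure_mono z2 closure_Un_frontier by blast
    then have "z2 \<in> inside ?J" using f z2 c1c2 c2c un by blast
    then show False using z2 inside_no_overlap by blast
  next
    case 2
    then have "z1 \<in> ?I2 \<union> frontier ?I2" using closure_mono z1 closure_Un_frontier by blast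
    then have "z1 \<in> inside ?J" using f z1 c1c2 c1c un by blast
    then show False using z1 inside_no_overlap by blast
  qed
qed

text \<open>The sets to which \<open>theta_crossing\<close> is applied must lie strictly inside the
  outer curve and reach it only in the closure, so chords are used without their outer ends. The
  open-ended arc is the image of \<open>{0..<1}\<close>.\<close>

lemma arc_minus_end:
  fixes g :: "real \<Rightarrow> 'a::real_normed_vector"
  assumes "arc g"
  shows "connected (path_image g - {pathfinish g})" "pathfinish g \<in> closure (path_image g - {pathfinish g})"
proof -
  have inj: "inj_on g {0..1}" and c: "continuous_on {0..1} g"
    using assms by (auto simp: arc_def path_def)
  have eq: "path_image g - {pathfinish g} = g ` {0..<1}"
  proof
    show "path_image g - {pathfinish g} \<subseteq> g ` {0..<1}"
    proof
      fix y assume "y \<in> path_image g - {pathfinish g}"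
      then obtain t where "0 \<le> t" "t \<le> 1" "y = g t" "g t \<noteq> g 1"
        by (auto simp: path_image_def pathfinish_def)
      then have "t \<in> {0..<1}" by (cases "t = 1") auto
      then show "y \<in> g ` {0..<1}" using \<open>y = g t\<close> by blast
    qed
    show "g ` {0..<1} \<subseteq> path_image g - {pathfinish g}"
    proof
      fix y assume "y \<in> g ` {0..<1}"
      then obtain t where t: "0 \<le> t" "t < 1" "y = g t" by auto
      then have "g t \<noteq> g 1" using inj_onD[OF inj, of t 1] by auto
      then show "y \<in> path_image g - {pathfinish g}"
        using t by (auto simp: path_image_def pathfinish_def)
    qed
  qed
  have c': "continuous_on {0..<1} g" by (rule continuous_on_subset[OF c]) auto
  have "connected {0..<1::real}" by simp
  from connected_continuous_image[OF c' this]
  show "connected (path_image g - {pathfinish g})" using eq by simp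
  have "closure {0..<1::real} = {0..1}" by simp
  then have "g ` {0..1} \<subseteq> closure (g ` {0..<1})"
    using image_closure_subset[of "{0..<1}" g "closure (g ` {0..<1})"] c
      closure_subset[of "g ` {0..<1}"] by simp
  then show "pathfinish g \<in> closure (path_image g - {pathfinish g})"
    unfolding eq by (auto simp: pathfinish_def)
qed

section \<open>Plane graphs: paths as arcs, and intersections of curves\<close>

locale plane_graph =
  fixes G :: "('v, 'e) mgraph" and pt :: "'v \<Rightarrow> complex" and cv :: "'e \<Rightarrow> complex set"
  assumes simple: "simple_graph G" and plane: "plane_embedding G pt cv"
begin

lemma ends_verts: "e \<in> edges G \<Longrightarrow> ends G e \<subseteq> verts G"
  using simple unfolding simple_graph_def wf_mgraph_def by auto

lemma embedding_facts:
  assumes "e \<in> edges G"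
  shows "\<exists>g. simple_path g \<and> path_image g = cv e \<and> {pathstart g, pathfinish g} = pt ` ends G e"
    and "cv e \<inter> pt ` verts G = pt ` ends G e"
    and "f \<in> edges G \<Longrightarrow> e \<noteq> f \<Longrightarrow> cv e \<inter> cv f = pt ` (ends G e \<inter> ends G f)"
  using plane[unfolded plane_embedding_def] assms by simp_all

lemma pt_inj: "u \<in> verts G \<Longrightarrow> v \<in> verts G \<Longrightarrow> pt u = pt v \<longleftrightarrow> u = v"
  using plane unfolding plane_embedding_def by (auto dest: inj_onD)

lemma vertices_on_verts: "F \<subseteq> edges G \<Longrightarrow> vertices_on G F \<subseteq> verts G"
  using ends_verts unfolding vertices_on_def by blast

lemma pt_in_cv: "e \<in> edges G \<Longrightarrow> v \<in> verts G \<Longrightarrow> pt v \<in> cv e \<longleftrightarrow> v \<in> ends G e"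
proof -
  assume e: "e \<in> edges G" and v: "v \<in> verts G"
  have *: "cv e \<inter> pt ` verts G = pt ` ends G e" by (rule embedding_facts(2)[OF e])
  show "pt v \<in> cv e \<longleftrightarrow> v \<in> ends G e"
  proof
    assume "pt v \<in> cv e"
    then have "pt v \<in> pt ` ends G e" using * v by blast
    then obtain u where "u \<in> ends G e" "pt v = pt u" by blast
    then show "v \<in> ends G e" using pt_inj[of v u] v ends_verts[OF e] by auto
  qed (use * in auto)
qed

lemma pt_in_curve: "F \<subseteq> edges G \<Longrightarrow> v \<in> verts G \<Longrightarrow> pt v \<in> curve cv F \<longleftrightarrow> v \<in> vertices_on G F"
  unfolding curve_def vertices_on_def using pt_in_cv by blast

text \<open>This turns every intersection of point sets needed below into an intersection of vertex
  sets.\<close>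

lemma curve_Int:
  assumes "E \<subseteq> edges G" "F \<subseteq> edges G" "E \<inter> F = {}"
  shows "curve cv E \<inter> curve cv F = pt ` (vertices_on G E \<inter> vertices_on G F)"
proof
  show "curve cv E \<inter> curve cv F \<subseteq> pt ` (vertices_on G E \<inter> vertices_on G F)"
  proof
    fix z assume "z \<in> curve cv E \<inter> curve cv F"
    then obtain e f where ef: "e \<in> E" "f \<in> F" "z \<in> cv e \<inter> cv f" by (auto simp: curve_def)
    then have "cv e \<inter> cv f = pt ` (ends G e \<inter> ends G f)"
      using embedding_facts(3)[of e f] assms by blast
    then show "z \<in> pt ` (vertices_on G E \<inter> vertices_on G F)"
      using ef unfolding vertices_on_def by blast
  qed
  show "pt ` (vertices_on G E \<inter> vertices_on G F) \<subseteq> curve cv E \<inter> curve cv F"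
    using pt_in_curve assms vertices_on_verts by blast
qed

lemma edge_arc:
  assumes "e \<in> edges G" "ends G e = {u, v}"
  obtains g where "arc g" "path_image g = cv e" "pathstart g = pt u" "pathfinish g = pt v"
proof -
  obtain g where g: "simple_path g" "path_image g = cv e" "{pathstart g, pathfinish g} = pt ` ends G e"
    using embedding_facts(1)[OF assms(1)] by blast
  have "card (ends G e) = 2" using simple assms(1) unfolding simple_graph_def by blast
  then have "u \<noteq> v" using assms(2) by auto
  then have ne: "pt u \<noteq> pt v" using pt_inj[of u v] ends_verts[OF assms(1)] assms(2) by auto
  have st: "{pathstart g, pathfinish g} = {pt u, pt v}" using g(3) assms(2) by simp
  then have "arc g" using g(1) ne by (metis simple_path_imp_arc doubleton_eq_iff)
  then show thesis
  proof (cases "pathstart g = pt u")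
    case True
    then show thesis using that[of g] \<open>arc g\<close> g st by (auto simp: doubleton_eq_iff)
  next
    case False
    then have "pathstart g = pt v" "pathfinish g = pt u" using st by (auto simp: doubleton_eq_iff)
    then show thesis using that[of "reversepath g"] \<open>arc g\<close> g by (simp add: arc_reversepath)
  qed
qed

lemma gpath_arc:
  assumes "gpath G vs es" "es \<noteq> []"
  obtains g where "arc g" "path_image g = curve cv (set es)"
    "pathstart g = pt (hd vs)" "pathfinish g = pt (last vs)"
proof -
  \<comment> \<open>The graph is a variable of \<open>gpath.induct\<close>, hence the copy
    \<open>H\<close> tied to \<open>G\<close> by an equation.\<close>
  have "\<exists>g. arc g \<and> path_image g = curve cv (set es) \<and>
      pathstart g = pt (hd vs) \<and> pathfinish g = pt (last vs)"
    if "gpath H vs es" "es \<noteq> []" "H = G" for H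
    using that
  proof (induction H vs es rule: gpath.induct)
    case (4 H u v vs e es)
    obtain g where g: "arc g" "path_image g = cv e" "pathstart g = pt u" "pathfinish g = pt v"
      using edge_arc[of e u v] 4 by auto
    show ?case
    proof (cases "es = []")
      case True
      then have "vs = []" using 4 by (cases vs) auto
      then show ?thesis using g True by (intro exI[of _ g]) (auto simp: curve_def)
    next
      case False
      then obtain h where h: "arc h" "path_image h = curve cv (set es)"
          "pathstart h = pt v" "pathfinish h = pt (last (v # vs))"
        using 4 by auto
      have p: "gpath G (v # vs) es" using 4 by simp
      have E: "e \<in> edges G" "ends G e = {u, v}" "u \<notin> set (v # vs)" using 4 by auto
      have V: "vertices_on G (set es) \<subseteq> set (v # vs)" by (rule gpath_vertices_on[OF p])
      then have "e \<notin> set es" using E by (auto simp: vertices_on_def)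
      then have "curve cv {e} \<inter> curve cv (set es) = pt ` (vertices_on G {e} \<inter> vertices_on G (set es))"
        using curve_Int[of "{e}" "set es"] E gpath_edges[OF p] by auto
      then have "path_image g \<inter> path_image h \<subseteq> {pathstart h}"
        using g h V E by (auto simp: curve_def vertices_on_def)
      then have "arc (g +++ h)" using g h by (intro arc_join) auto
      then show ?thesis using g h by (intro exI[of _ "g +++ h"]) (auto simp: path_image_join curve_def)
    qed
  qed auto
  then show thesis using assms that by blast
qed

text \<open>The vertex points are added because a path with a single vertex has an empty
  curve.\<close>

lemma gpath_connected:
  assumes "gpath G vs es" "set vs \<subseteq> verts G"
  shows "connected (pt ` set vs \<union> curve cv (set es))"
proof (cases "es = []")
  case True
  then obtain v where "vs = [v]" using gpath_length[OF assms(1)] by (cases vs) auto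
  then show ?thesis using True by (simp add: curve_def)
next
  case False
  then obtain g where g: "arc g" "path_image g = curve cv (set es)" using gpath_arc assms by metis
  have "pt ` set vs \<subseteq> curve cv (set es)"
    using gpath_vertices_on_eq[OF assms(1) False] pt_in_curve[OF gpath_edges[OF assms(1)]] assms(2) by auto
  then show ?thesis using g connected_path_image arc_imp_path by (metis sup.absorb2)
qed

text \<open>The chords \<open>p - a - b - p'\<close> and \<open>i\<^sub>1 - o\<^sub>1 - \<dots> - o\<^sub>2 - i\<^sub>2\<close> of the disc bounded by the outer cycle would
  have to cross, since their ends alternate on that cycle.\<close>

lemma annulus_noncrossing:
  assumes D: "is_cycle G D" and E: "is_cycle G E"
    and DE: "vertices_on G D \<inter> vertices_on G E = {}"
    and ins: "curve cv D \<subseteq> inside (curve cv E)"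
    and q: "q \<in> D" "ends G q = {a, b}"
    and e: "e \<in> edges G" "ends G e = {a, p}" and e': "e' \<in> edges G" "ends G e' = {b, p'}"
    and p1: "gpath G vs1 es1" "hd vs1 = p" "last vs1 = p'"
    and p2: "gpath G vs2 es2" "hd vs2 = p" "last vs2 = p'"
    and un: "set es1 \<union> set es2 = E" and disj: "set es1 \<inter> set es2 = {}"
    and vs12: "set vs1 \<inter> set vs2 = {p, p'}" and pp': "p \<noteq> p'"
    and f1: "f1 \<in> edges G" "ends G f1 = {o1, i1}" "o1 \<in> vertices_on G D" "o1 \<noteq> a" "o1 \<noteq> b"
      "i1 \<in> set vs1 - {p, p'}"
    and f2: "f2 \<in> edges G" "ends G f2 = {o2, i2}" "o2 \<in> vertices_on G D" "o2 \<noteq> a" "o2 \<noteq> b"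
      "i2 \<in> set vs2 - {p, p'}"
  shows False
proof -
  have DG: "D \<subseteq> edges G" and EG: "E \<subseteq> edges G" using D E unfolding is_cycle_def by auto
  have es: "es1 \<noteq> []" "es2 \<noteq> []"
    using gpath_length[OF p1(1)] gpath_length[OF p2(1)] p1 p2 pp' by (cases vs1; cases vs2; auto)+
  note V1 = gpath_vertices_on_eq[OF p1(1) es(1)] and V2 = gpath_vertices_on_eq[OF p2(1) es(2)]
  have VE: "vertices_on G E = set vs1 \<union> set vs2" using un V1 V2 by (auto simp: vertices_on_def)
  have esG: "set es1 \<subseteq> edges G" "set es2 \<subseteq> edges G" using un EG by auto
  have pE: "p \<in> vertices_on G E" "p' \<in> vertices_on G E" using VE vs12 by auto
  have ab: "a \<in> vertices_on G D" "b \<in> vertices_on G D" using q by (auto simp: vertices_on_def)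
  have nE: "a \<notin> vertices_on G E" "b \<notin> vertices_on G E" "o1 \<notin> vertices_on G E" "o2 \<notin> vertices_on G E"
    using ab f1 f2 DE by auto
  have nD: "z \<notin> vertices_on G D" if "z \<in> vertices_on G E" for z using that DE by auto
  have iE: "i1 \<in> vertices_on G E" "i2 \<in> vertices_on G E" using f1 f2 VE by auto
  have qG: "q \<in> edges G" using q DG by auto
  have qE: "q \<notin> E" using q nE by (auto simp: vertices_on_def)
  have eE: "e \<notin> E" "e' \<notin> E" using e e' nE by (auto simp: vertices_on_def)
  have "card (ends G q) = 2" using simple qG unfolding simple_graph_def by auto
  then have "a \<noteq> b" using q by auto
  have cp: "gpath G [p, a, b, p'] [e, q, e']"
    using e e' q qG pE nE pp' \<open>a \<noteq> b\<close> by auto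
  obtain c1 where c1: "arc c1" "path_image c1 = curve cv (set es1)" "pathstart c1 = pt p" "pathfinish c1 = pt p'"
    using gpath_arc[OF p1(1) es(1)] p1 by metis
  obtain c2 where c2: "arc c2" "path_image c2 = curve cv (set es2)" "pathstart c2 = pt p" "pathfinish c2 = pt p'"
    using gpath_arc[OF p2(1) es(2)] p2 by metis
  obtain c where c: "arc c" "path_image c = curve cv {e, q, e'}" "pathstart c = pt p" "pathfinish c = pt p'"
    using gpath_arc[OF cp] by auto
  have J: "path_image c1 \<union> path_image c2 = curve cv E" using c1 c2 un by (auto simp: curve_def)
  have cG: "{e, q, e'} \<subseteq> edges G" using e e' qG by auto
  have Vc: "vertices_on G {e, q, e'} = {p, a, b, p'}" using e e' q by (auto simp: vertices_on_def)
  have i12: "path_image c1 \<inter> path_image c2 = {pt p, pt p'}"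
    using curve_Int[OF esG disj] c1 c2 V1 V2 vs12 by simp
  have i1c: "path_image c1 \<inter> path_image c = {pt p, pt p'}"
  proof -
    have "set es1 \<inter> {e, q, e'} = {}" using un eE qE by auto
    moreover have "set vs1 \<inter> {p, a, b, p'} = {p, p'}" using VE nE vs12 by auto
    ultimately show ?thesis using curve_Int[OF esG(1) cG] c1 c V1 Vc by simp
  qed
  have i2c: "path_image c2 \<inter> path_image c = {pt p, pt p'}"
  proof -
    have "set es2 \<inter> {e, q, e'} = {}" using un eE qE by auto
    moreover have "set vs2 \<inter> {p, a, b, p'} = {p, p'}" using VE nE vs12 by auto
    ultimately show ?thesis using curve_Int[OF esG(2) cG] c2 c V2 Vc by simp
  qed
  have Vv: "vertices_on G D \<subseteq> verts G" "vertices_on G E \<subseteq> verts G"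
    using vertices_on_verts DG EG by auto
  have ptD: "pt v \<in> curve cv D" if "v \<in> vertices_on G D" for v
    using pt_in_curve[OF DG] that Vv by blast
  have ne: "path_image c \<inter> inside (path_image c1 \<union> path_image c2) \<noteq> {}"
  proof -
    have "pt a \<in> path_image c" using pt_in_curve[OF cG, of a] Vc ab Vv c by auto
    then show ?thesis using ptD[OF ab(1)] ins J by auto
  qed
  \<comment> \<open>Without \<open>q\<close> and the ends of \<open>q\<close>, the cycle
    \<open>D\<close> is still a path, \<open>ws\<close>, possibly a single vertex. It contains
    \<open>o1\<close> and \<open>o2\<close> and will be the middle piece linking the two
    chords.\<close>
  obtain us fs where u: "gpath G us fs" "set fs = D - {q}" "ends G q = {hd us, last us}"
      "set us = vertices_on G D" "3 \<le> length us"
    using cycle_path[OF simple D q(1)] by blast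
  obtain a' us1 where us1: "us = a' # us1" using u(5) by (cases us) auto
  obtain ws b' where us: "us = a' # ws @ [b']" using u(5) us1 by (cases us1 rule: rev_exhaust) auto
  have "ws \<noteq> []" using u(5) us by auto
  then obtain w ws' where w: "ws = w # ws'" by (cases ws) auto
  obtain f fs' where fs: "fs = f # fs'" using u(1) us w by (cases fs) auto
  have "gpath G (ws @ [b']) fs'" using u(1) us w fs by simp
  moreover obtain ws'' d where wd: "ws = ws'' @ [d]" using \<open>ws \<noteq> []\<close> by (cases ws rule: rev_exhaust) auto
  ultimately obtain mid es2 where mid: "fs' = mid @ es2" "gpath G ws mid"
    using gpath_split[of G ws'' d "[b']" fs'] by auto
  have du: "distinct us" by (rule gpath_distinct[OF u(1)])
  have "{a', b'} = {a, b}" using u(3) us q(2) by simp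
  then have wsab: "set ws = vertices_on G D - {a, b}" using u(4) us du by auto
  have midD: "set mid \<subseteq> D - {q}" using u(2) fs mid by auto
  define N where "N = pt ` set ws \<union> curve cv (set mid)"
  have Ncon: "connected N" unfolding N_def using gpath_connected[OF mid(2)] wsab Vv by auto
  have ND: "N \<subseteq> curve cv D"
    unfolding N_def using ptD wsab midD by (auto simp: curve_def)
  have "N \<inter> path_image c = {}"
  proof -
    have m: "vertices_on G (set mid) \<subseteq> set ws" by (rule gpath_vertices_on[OF mid(2)])
    have sw: "set ws \<inter> {p, a, b, p'} = {}" using wsab pE nD by auto
    have "e \<notin> D" "e' \<notin> D" using e e' pE nD by (auto simp: vertices_on_def)
    then have d0: "set mid \<inter> {e, q, e'} = {}" using midD by auto
    have "vertices_on G (set mid) \<inter> {p, a, b, p'} = {}" using sw m by blast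
    then have "curve cv (set mid) \<inter> path_image c = {}"
      using curve_Int[OF _ cG d0] midD DG c(2) Vc by auto
    moreover have "pt v \<notin> path_image c" if "v \<in> set ws" for v
    proof -
      have "v \<in> verts G" using that wsab Vv by auto
      then show ?thesis using pt_in_curve[OF cG] Vc sw that c(2) by auto
    qed
    ultimately show ?thesis unfolding N_def by auto
  qed
  \<comment> \<open>What \<open>theta_crossing\<close> needs of \<open>f1\<close> and
    \<open>f2\<close>: stripped of the end on \<open>E\<close>, such an edge is a connected set off
    \<open>E\<close> and off the path \<open>p - a - b - p'\<close>, with the lost end in its
    closure.\<close>
  have chord: "connected (cv g - {pt i}) \<and> pt i \<in> closure (cv g - {pt i}) \<and> pt y \<in> cv g - {pt i} \<and>
      (cv g - {pt i}) \<inter> curve cv E = {} \<and> cv g \<inter> path_image c = {}"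
    if g: "g \<in> edges G" "ends G g = {y, i}" "y \<in> vertices_on G D" "y \<noteq> a" "y \<noteq> b"
      "i \<in> vertices_on G E - {p, p'}" for g y i
  proof -
    obtain h where h: "arc h" "path_image h = cv g" "pathstart h = pt y" "pathfinish h = pt i"
      using edge_arc g by metis
    have "pt y \<noteq> pt i" using pt_inj[of y i] g Vv nD by auto
    moreover have "pt y \<in> cv g" using h by (metis pathstart_in_path_image)
    moreover have "(cv g - {pt i}) \<inter> curve cv E = {}"
    proof -
      have yE: "y \<notin> vertices_on G E" using g DE by auto
      then have "g \<notin> E" using g by (auto simp: vertices_on_def)
      then have "cv g \<inter> curve cv E = pt ` ({y, i} \<inter> vertices_on G E)"
        using curve_Int[of "{g}" E] g EG by (simp add: curve_def vertices_on_def)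
      then show ?thesis using yE by auto
    qed
    moreover have "cv g \<inter> path_image c = {}"
    proof -
      have d: "{y, i} \<inter> {p, a, b, p'} = {}" using g pE nD ab by auto
      then have "g \<noteq> e" "g \<noteq> e'" "g \<noteq> q" using g e e' q by auto
      then show ?thesis
        using curve_Int[of "{g}" "{e, q, e'}"] g cG d Vc c(2) by (simp add: curve_def vertices_on_def)
    qed
    ultimately show ?thesis using arc_minus_end[OF h(1)] h by auto
  qed
  note k1 = chord[OF f1(1,2,3,4,5)] and k2 = chord[OF f2(1,2,3,4,5)]
  have k1: "connected (cv f1 - {pt i1})" "pt i1 \<in> closure (cv f1 - {pt i1})" "pt o1 \<in> cv f1 - {pt i1}"
      "(cv f1 - {pt i1}) \<inter> curve cv E = {}" "cv f1 \<inter> path_image c = {}"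
    using k1 f1 VE by auto
  have k2: "connected (cv f2 - {pt i2})" "pt i2 \<in> closure (cv f2 - {pt i2})" "pt o2 \<in> cv f2 - {pt i2}"
      "(cv f2 - {pt i2}) \<inter> curve cv E = {}" "cv f2 \<inter> path_image c = {}"
    using k2 f2 VE by auto
  have oN: "pt o1 \<in> N" "pt o2 \<in> N" using wsab f1 f2 by (auto simp: N_def)
  define K where "K = (cv f1 - {pt i1}) \<union> N \<union> (cv f2 - {pt i2})"
  have "connected ((cv f1 - {pt i1}) \<union> N)" using k1 oN Ncon by (intro connected_Un) auto
  from connected_Un[OF this k2(1)] have Kcon: "connected K" unfolding K_def using k2(3) oN by blast
  have "curve cv D \<inter> curve cv E = {}" using ins inside_no_overlap by blast
  then have KE: "K \<inter> curve cv E = {}" unfolding K_def using k1 k2 ND by auto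
  \<comment> \<open>\<open>K\<close> is connected, misses the curve of \<open>E\<close>, and
    contains a point of \<open>D\<close>, which lies inside \<open>E\<close>.\<close>
  have "K \<subseteq> inside (curve cv E)"
  proof -
    have "simple_path (c1 +++ reversepath c2)"
      using c1 c2 i12 by (intro simple_path_join_loop) (auto intro: arc_reversepath)
    moreover have im: "path_image (c1 +++ reversepath c2) = curve cv E"
      using c1 c2 J by (simp add: path_image_join)
    ultimately have JE: "open (inside (curve cv E))" "open (outside (curve cv E))"
      using Jordan_inside_outside[of "c1 +++ reversepath c2"] c1 c2 by auto
    have "K \<subseteq> inside (curve cv E) \<union> outside (curve cv E)"
      using KE inside_Un_outside by blast
    moreover have "inside (curve cv E) \<inter> K \<noteq> {}"
      using oN ND ins K_def by blast
    ultimately show ?thesis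
      using connectedD[OF Kcon JE] inside_Int_outside by blast
  qed
  moreover have "K \<inter> path_image c = {}"
    unfolding K_def using k1 k2 \<open>N \<inter> path_image c = {}\<close> by auto
  moreover have "pt i1 \<in> closure K" "pt i2 \<in> closure K"
    using k1(2) k2(2) closure_mono[of "cv f1 - {pt i1}" K] closure_mono[of "cv f2 - {pt i2}" K]
    by (auto simp: K_def)
  moreover have "pt i1 \<in> path_image c1 - {pt p, pt p'}"
    using pt_in_curve[OF esG(1), of i1] V1 f1 iE pE Vv pt_inj[of i1 p] pt_inj[of i1 p'] c1 by auto
  moreover have "pt i2 \<in> path_image c2 - {pt p, pt p'}"
    using pt_in_curve[OF esG(2), of i2] V2 f2 iE pE Vv pt_inj[of i2 p] pt_inj[of i2 p'] c2 by auto
  ultimately show False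
    using theta_crossing[OF c1(1,3,4) c2(1,3,4) c(1,3,4) i12 i1c i2c ne Kcon, of "pt i1" "pt i2"] J by simp
qed

end

section \<open>Annular graphs\<close>

locale annular_graph = plane_graph G pt cv
  for G :: "('v, 'e) mgraph" and pt cv +
  fixes C :: "nat \<Rightarrow> 'e set" and x :: nat
  assumes cubic: "regular 3 G" and bip: "bipartite G" and conn: "connected_graph G"
    and embedding: "annular_embedding G pt cv C x"
begin

abbreviation VC :: "nat \<Rightarrow> 'v set" where "VC k \<equiv> vertices_on G (C k)"

lemma C_cycle: "k \<le> x \<Longrightarrow> is_cycle G (C k)"
  and VC_disjoint: "i \<le> x \<Longrightarrow> j \<le> x \<Longrightarrow> i \<noteq> j \<Longrightarrow> VC i \<inter> VC j = {}"
  and C_inside: "k < x \<Longrightarrow> curve cv (C k) \<subseteq> inside (curve cv (C (Suc k)))"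
  and verts_eq: "verts G = (\<Union>k\<le>x. VC k)"
  and edges_eq: "edges G = (\<Union>k\<le>x. C k) \<union> (\<Union>k\<in>{1..x}. annulus_edges G C k)"
proof -
  note emb = embedding[unfolded annular_embedding_def]
  show "k \<le> x \<Longrightarrow> is_cycle G (C k)" "i \<le> x \<Longrightarrow> j \<le> x \<Longrightarrow> i \<noteq> j \<Longrightarrow> VC i \<inter> VC j = {}"
    "verts G = (\<Union>k\<le>x. VC k)"
    "edges G = (\<Union>k\<le>x. C k) \<union> (\<Union>k\<in>{1..x}. annulus_edges G C k)"
    using emb by simp_all
  assume "k < x"
  then have "Suc k \<in> {1..x}" by simp
  moreover have "\<forall>k\<in>{1..x}. curve cv (C (k - 1)) \<subseteq> inside (curve cv (C k))" using emb by simp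
  ultimately show "curve cv (C k) \<subseteq> inside (curve cv (C (Suc k)))" by fastforce
qed

lemma C_edges: "k \<le> x \<Longrightarrow> C k \<subseteq> edges G"
  using C_cycle unfolding is_cycle_def by blast

lemma VC_unique: "v \<in> VC i \<Longrightarrow> v \<in> VC j \<Longrightarrow> i \<le> x \<Longrightarrow> j \<le> x \<Longrightarrow> i = j"
  using VC_disjoint by blast

lemma ends_card: "e \<in> edges G \<Longrightarrow> card (ends G e) = 2"
  using simple unfolding simple_graph_def by blast

lemma C_ends: "e \<in> C k \<Longrightarrow> ends G e \<subseteq> VC k"
  by (auto simp: vertices_on_def)

lemma annulus_edgeE:
  assumes "e \<in> annulus_edges G C (Suc k)"
  obtains u v where "e \<in> edges G" "u \<in> VC k" "v \<in> VC (Suc k)" "ends G e = {u, v}"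
  using assms unfolding annulus_edges_def by auto

lemma annulus_edge_not_C:
  assumes "e \<in> annulus_edges G C (Suc k)" "k < x" "j \<le> x"
  shows "e \<notin> C j"
proof
  assume "e \<in> C j"
  obtain u v where "u \<in> VC k" "v \<in> VC (Suc k)" "ends G e = {u, v}"
    using assms(1) by (rule annulus_edgeE)
  then have "u \<in> VC j" "v \<in> VC j" using C_ends[OF \<open>e \<in> C j\<close>] by auto
  then have "j = k" "j = Suc k" using VC_unique assms \<open>u \<in> VC k\<close> \<open>v \<in> VC (Suc k)\<close>
    by (metis Suc_leI less_imp_le)+
  then show False by simp
qed

lemma finite_edges: "finite (edges G)"
  using simple unfolding simple_graph_def wf_mgraph_def by blast

lemma no_loop: "e \<in> edges G \<Longrightarrow> ends G e \<noteq> {v}"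
  using ends_card by fastforce

lemma degree_G: "v \<in> verts G \<Longrightarrow> card {e \<in> edges G. v \<in> ends G e} = 3"
proof -
  assume "v \<in> verts G"
  then have "degree G v = 3" using cubic unfolding regular_def by blast
  moreover have "{e \<in> edges G. ends G e = {v}} = {}" using no_loop by blast
  ultimately show ?thesis unfolding degree_def by simp
qed

text \<open>Of the three edges at \<open>v\<close>, two belong to the cycle through
  \<open>v\<close>. The remaining one decides whether \<open>v\<close> is outward.\<close>

lemma third_edge:
  assumes "k \<le> x" "v \<in> VC k"
  obtains e where "e \<notin> C k" "{f \<in> edges G. v \<in> ends G f} = insert e {f \<in> C k. v \<in> ends G f}"
proof -
  have v: "v \<in> verts G" using assms verts_eq by auto
  have 2: "card {f \<in> C k. v \<in> ends G f} = 2"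
    using cycle_incident[OF simple C_cycle[OF assms(1)] assms(2)] .
  have sub: "{f \<in> C k. v \<in> ends G f} \<subseteq> {f \<in> edges G. v \<in> ends G f}" using C_edges assms by auto
  have fin: "finite {f \<in> edges G. v \<in> ends G f}" using finite_edges by simp
  have "card ({f \<in> edges G. v \<in> ends G f} - {f \<in> C k. v \<in> ends G f}) = 1"
    using card_Diff_subset[OF finite_subset[OF sub fin] sub] degree_G[OF v] 2 by simp
  then obtain e where e: "{f \<in> edges G. v \<in> ends G f} - {f \<in> C k. v \<in> ends G f} = {e}"
    by (rule card_1_singletonE)
  then have "e \<notin> C k" by blast
  moreover have "{f \<in> edges G. v \<in> ends G f} = insert e {f \<in> C k. v \<in> ends G f}"
    using e sub by blast
  ultimately show thesis using that by blast
qed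

lemma third_edge_unique:
  assumes "k \<le> x" "v \<in> VC k" "e \<in> edges G" "v \<in> ends G e" "e \<notin> C k"
    "f \<in> edges G" "v \<in> ends G f" "f \<notin> C k"
  shows "e = f"
proof -
  obtain g where "{f \<in> edges G. v \<in> ends G f} = insert g {f \<in> C k. v \<in> ends G f}"
    using third_edge assms by blast
  then have "e \<in> insert g {f \<in> C k. v \<in> ends G f}" "f \<in> insert g {f \<in> C k. v \<in> ends G f}"
    using assms by auto
  then show ?thesis using assms by blast
qed

section \<open>Outward and inward vertices\<close>

text \<open>Quantifying over the cycle makes this a property of the vertex alone. For a vertex of a
  cycle, \<open>not_outwardE\<close> turns the negation into an edge to the previous cycle, so
  "inward" needs no definition of its own.\<close>

definition outward :: "'v \<Rightarrow> bool" where
  "outward v \<longleftrightarrow> (\<exists>k<x. v \<in> VC k \<and> (\<exists>e\<in>annulus_edges G C (Suc k). v \<in> ends G e))"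

lemma outwardE:
  assumes "outward v" "v \<in> VC k" "k \<le> x"
  obtains e u where "k < x" "e \<in> annulus_edges G C (Suc k)" "ends G e = {v, u}" "u \<in> VC (Suc k)"
    "\<not> outward u" "e \<in> edges G"
proof -
  obtain j e where j: "j < x" "v \<in> VC j" and e: "e \<in> annulus_edges G C (Suc j)" "v \<in> ends G e"
    using assms(1) unfolding outward_def by blast
  have "j = k" using VC_unique assms j by simp
  note j = j[unfolded this] and e = e[unfolded this]
  obtain a b where ab: "e \<in> edges G" "a \<in> VC k" "b \<in> VC (Suc k)" "ends G e = {a, b}"
    using e(1) by (rule annulus_edgeE)
  have "v \<noteq> b" using VC_unique[of v k "Suc k"] j ab by auto
  then have "v = a" using e ab by auto
  \<comment> \<open>An outward edge at \<open>b\<close> would be a second edge off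
    \<open>C (Suc k)\<close> at \<open>b\<close>, hence \<open>e\<close> itself; but
    \<open>e\<close> has no end on \<open>C (Suc (Suc k))\<close>.\<close>
  have "\<not> outward b"
  proof
    assume "outward b"
    then obtain i f where i: "i < x" "b \<in> VC i" and f: "f \<in> annulus_edges G C (Suc i)" "b \<in> ends G f"
      unfolding outward_def by blast
    have "i = Suc k" using VC_unique[of b i "Suc k"] i ab j by simp
    note i = i[unfolded this] and f = f[unfolded this]
    obtain c d where cd: "f \<in> edges G" "c \<in> VC (Suc k)" "d \<in> VC (Suc (Suc k))" "ends G f = {c, d}"
      using f(1) by (rule annulus_edgeE)
    have "f \<notin> C (Suc k)" "e \<notin> C (Suc k)"
      using annulus_edge_not_C f(1) e(1) i j by auto
    then have "e = f" using third_edge_unique[of "Suc k" b e f] ab cd f i by auto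
    then have "d = a \<or> d = b" using ab cd by auto
    then show False using VC_unique[of d "Suc (Suc k)" k] VC_unique[of d "Suc (Suc k)" "Suc k"] ab cd i by auto
  qed
  then show thesis using that j e ab \<open>v = a\<close> by blast
qed

text \<open>An edge on none of the cycles lies in some annulus, so a third edge that does not lead
  outward comes from the previous cycle. In particular every vertex of \<open>C 0\<close> is
  outward.\<close>

lemma not_outwardE:
  assumes "\<not> outward u" "u \<in> VC k" "k \<le> x"
  obtains j e v where "k = Suc j" "e \<in> annulus_edges G C k" "ends G e = {v, u}" "v \<in> VC j"
    "outward v" "e \<in> edges G"
proof -
  obtain e where e: "e \<notin> C k" "{f \<in> edges G. u \<in> ends G f} = insert e {f \<in> C k. u \<in> ends G f}"
    using third_edge assms by blast
  then have eu: "e \<in> edges G" "u \<in> ends G e" by auto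
  have "e \<notin> C j" if "j \<le> x" for j
    using e(1) eu(2) C_ends[of e j] VC_unique[of u j k] assms that by auto
  then obtain i where i: "i \<in> {1..x}" "e \<in> annulus_edges G C i" using eu edges_eq by auto
  then obtain j where j: "i = Suc j" "j < x" by (cases i) auto
  obtain a b where ab: "a \<in> VC j" "b \<in> VC (Suc j)" "ends G e = {a, b}"
    using i(2) unfolding j(1) by (rule annulus_edgeE)
  have a: "outward a" unfolding outward_def using ab i j by auto
  then have "u = b" using assms(1) eu ab by auto
  then have "k = Suc j" using VC_unique[of b "Suc j" k] ab j assms by auto
  then show thesis using that[of j e a] i j ab eu a \<open>u = b\<close> by simp
qed

lemma annulus_edge_ends:
  assumes "e \<in> annulus_edges G C (Suc k)" "k < x"
  obtains v u where "ends G e = {v, u}" "v \<in> VC k" "u \<in> VC (Suc k)" "outward v" "\<not> outward u" "e \<in> edges G"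
proof -
  obtain a b where ab: "e \<in> edges G" "a \<in> VC k" "b \<in> VC (Suc k)" "ends G e = {a, b}"
    using assms(1) by (rule annulus_edgeE)
  have "outward a" unfolding outward_def using ab assms by auto
  then obtain f w where f: "f \<in> annulus_edges G C (Suc k)" "ends G f = {a, w}" "w \<in> VC (Suc k)"
      "\<not> outward w" "f \<in> edges G"
    using outwardE[of a k] ab assms by (metis less_imp_le)
  have "e = f" using third_edge_unique[of k a e f] annulus_edge_not_C[of e k k] annulus_edge_not_C[of f k k]
      assms ab f by auto
  then have "w = b" using ab f ends_card[of e] by (auto simp: doubleton_eq_iff)
  then show thesis using that ab f \<open>outward a\<close> by blast
qed

lemma outward_unique:
  assumes "k < x" "v \<in> VC k" "e \<in> annulus_edges G C (Suc k)" "v \<in> ends G e"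
    "f \<in> annulus_edges G C (Suc k)" "v \<in> ends G f"
  shows "e = f"
  using third_edge_unique[of k v e f] annulus_edge_not_C[of _ k k] assms
  by (auto elim: annulus_edgeE)

lemma inward_unique:
  assumes "k < x" "v \<in> VC (Suc k)" "e \<in> annulus_edges G C (Suc k)" "v \<in> ends G e"
    "f \<in> annulus_edges G C (Suc k)" "v \<in> ends G f"
  shows "e = f"
  using third_edge_unique[of "Suc k" v e f] annulus_edge_not_C[of _ k "Suc k"] assms
  by (auto elim: annulus_edgeE)

text \<open>With an empty annulus the vertices of the cycles up to \<open>C k\<close> would be
  closed under adjacency, and connectivity would carry them to a vertex of
  \<open>C x\<close>.\<close>

lemma annulus_edges_nonempty:
  assumes "k < x"
  shows "annulus_edges G C (Suc k) \<noteq> {}"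
proof
  assume E: "annulus_edges G C (Suc k) = {}"
  define S where "S = (\<Union>i\<le>k. VC i)"
  have ne: "VC i \<noteq> {}" if i: "i \<le> x" for i
    using is_cycleE[OF simple C_cycle[OF i]] by (metis UNIV_not_empty image_is_empty)
  have closed: "v \<in> S" if a: "e \<in> edges G" "ends G e = {u, v}" "u \<in> S" for e u v
  proof -
    obtain i where i: "i \<le> k" "u \<in> VC i" using a(3) unfolding S_def by auto
    have "(\<exists>j\<le>x. e \<in> C j) \<or> (\<exists>j<x. e \<in> annulus_edges G C (Suc j))"
    proof -
      have "(\<exists>j\<le>x. e \<in> C j) \<or> (\<exists>j\<in>{1..x}. e \<in> annulus_edges G C j)" using a(1) edges_eq by auto
      then show ?thesis by (metis atLeastAtMost_iff Suc_le_eq Suc_pred' One_nat_def)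
    qed
    then show ?thesis
    proof
      assume "\<exists>j\<le>x. e \<in> C j"
      then obtain j where j: "j \<le> x" "e \<in> C j" by blast
      then have "u \<in> VC j" "v \<in> VC j" using C_ends a by auto
      then have "i = j" using VC_unique i j assms by simp
      then show ?thesis using \<open>v \<in> VC j\<close> i S_def by auto
    next
      assume "\<exists>j<x. e \<in> annulus_edges G C (Suc j)"
      then obtain j where j: "j < x" "e \<in> annulus_edges G C (Suc j)" by blast
      then have "j \<noteq> k" using E by auto
      obtain a b where ab: "a \<in> VC j" "b \<in> VC (Suc j)" "ends G e = {a, b}"
        using j(2) by (rule annulus_edgeE)
      have "u \<in> VC j \<or> u \<in> VC (Suc j)" using ab a by auto
      moreover have "i \<le> x" "j \<le> x" "Suc j \<le> x" using i(1) assms j(1) by simp_all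
      ultimately have "i = j \<or> i = Suc j"
        using VC_unique[of u i j] VC_unique[of u i "Suc j"] i(2) by blast
      then have "j \<le> k" "Suc j \<le> k" using i \<open>j \<noteq> k\<close> by auto
      moreover have "v = a \<or> v = b" using ab a by auto
      ultimately show ?thesis using ab S_def by auto
    qed
  qed
  obtain u where u: "u \<in> VC 0" using ne[of 0] by blast
  obtain w where w: "w \<in> VC x" using ne[of x] by blast
  have uw: "u \<in> verts G" "w \<in> verts G" using u w verts_eq by auto
  have "(u, w) \<in> {(a, b). \<exists>e\<in>edges G. ends G e = {a, b}}\<^sup>*"
    using conn uw unfolding connected_graph_def by blast
  moreover have "u \<in> S" using u S_def by auto
  ultimately have "w \<in> S"
  proof (induction rule: rtrancl_induct)
    case (step y z)
    then obtain e where "e \<in> edges G" "ends G e = {y, z}" by blast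
    then show ?case using closed step by blast
  qed
  then obtain i where "i \<le> k" "w \<in> VC i" using S_def by auto
  then show False using VC_unique[of w i x] w assms by auto
qed

end

section \<open>Parity of runs\<close>

text \<open>Builds an edge of the suppressed graph from an indexed walk. Injectivity of
  \<open>w\<close> is required on \<open>{0..<m}\<close> and on \<open>{Suc 0..m}\<close>
  separately, so that the two ends may coincide and the thread may become a loop.\<close>

lemma thread_ends:
  fixes w :: "nat \<Rightarrow> 'v"
  assumes m: "0 < m" and E: "\<And>t. t < m \<Longrightarrow> \<epsilon> t \<in> edges H \<and> ends H (\<epsilon> t) = {w t, w (Suc t)}"
    and inj: "inj_on \<epsilon> {0..<m}" "inj_on w {0..<m}" "inj_on w {Suc 0..m}"
    and deg: "\<And>t. 0 < t \<Longrightarrow> t < m \<Longrightarrow> degree H (w t) = 2" "degree H (w 0) \<noteq> 2" "degree H (w m) \<noteq> 2"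
  shows "is_thread H (\<epsilon> ` {0..<m})" "ends (suppress H) (\<epsilon> ` {0..<m}) = {w 0, w m}"
proof -
  have s: "Suc ` {0..<m} = {Suc 0..m}" by (auto simp: image_iff Bex_def)
  have bl: "butlast (map w [0..<Suc m]) = map w [0..<m]" by simp
  have tl: "tl (map w [0..<Suc m]) = map w [Suc 0..<Suc m]"
    by (simp add: upt_conv_Cons del: upt_Suc)
  have at: "(map w [0..<Suc m]) ! i = w i" if "i \<le> m" for i
    using that by (simp del: upt_Suc)
  show "is_thread H (\<epsilon> ` {0..<m})"
    unfolding is_thread_def
  proof (intro conjI exI[of _ "map w [0..<Suc m]"] exI[of _ "map \<epsilon> [0..<m]"])
    show "\<epsilon> ` {0..<m} \<subseteq> edges H" using E by auto
    show "map \<epsilon> [0..<m] \<noteq> []" using m by simp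
    show "distinct (map \<epsilon> [0..<m])" using inj by (simp add: distinct_map)
    show "distinct (butlast (map w [0..<Suc m]))" unfolding bl using inj by (simp add: distinct_map)
    show "distinct (tl (map w [0..<Suc m]))" unfolding tl using inj
      by (simp add: distinct_map atLeastLessThanSuc_atLeastAtMost del: upt_Suc)
    show "\<forall>i<length (map \<epsilon> [0..<m]). ends H (map \<epsilon> [0..<m] ! i) =
        {map w [0..<Suc m] ! i, map w [0..<Suc m] ! Suc i}"
      using E at by simp
    show "\<forall>i. 0 < i \<and> i < length (map \<epsilon> [0..<m]) \<longrightarrow> degree H (map w [0..<Suc m] ! i) = 2"
      using deg at by simp
    show "degree H (hd (map w [0..<Suc m])) \<noteq> 2" using deg by (simp add: hd_map del: upt_Suc)
    show "degree H (last (map w [0..<Suc m])) \<noteq> 2" using deg by (simp add: last_map)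
  qed auto
  have "vertices_on H (\<epsilon> ` {0..<m}) = w ` {0..m}"
  proof -
    have "vertices_on H (\<epsilon> ` {0..<m}) = (\<Union>t\<in>{0..<m}. {w t, w (Suc t)})"
      using E by (simp add: vertices_on_def)
    also have "\<dots> = w ` {0..<m} \<union> w ` (Suc ` {0..<m})" by blast
    also have "\<dots> = w ` {0..m}" unfolding s image_Un[symmetric] using m by (intro arg_cong[of _ _ "image w"]) auto
    finally show ?thesis .
  qed
  moreover have "{v \<in> w ` {0..m}. degree H v \<noteq> 2} = {w 0, w m}"
    using deg m by (auto) (metis gr0I le_neq_implies_less)
  ultimately show "ends (suppress H) (\<epsilon> ` {0..<m}) = {w 0, w m}" by (simp add: suppress_def)
qed

text \<open>Bipartiteness as a boolean colouring: two bipartitions can then be compared at a vertex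
  by an equation between truth values.\<close>

definition proper_coloring :: "('v, 'e) mgraph \<Rightarrow> ('v \<Rightarrow> bool) \<Rightarrow> bool" where
  "proper_coloring H c \<longleftrightarrow> (\<forall>e\<in>edges H. \<forall>u v. ends H e = {u, v} \<longrightarrow> c u \<noteq> c v)"

lemma proper_coloringD: "proper_coloring H c \<Longrightarrow> e \<in> edges H \<Longrightarrow> ends H e = {u, v} \<Longrightarrow> c u \<noteq> c v"
  unfolding proper_coloring_def by blast

lemma bipartite_coloring:
  assumes "bipartite H"
  obtains c where "proper_coloring H c"
proof -
  obtain A B where AB: "A \<union> B = verts H" "A \<inter> B = {}"
     "\<forall>e\<in>edges H. \<exists>a\<in>A. \<exists>b\<in>B. ends H e = {a, b}"
    using assms unfolding bipartite_def by blast
  show thesis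
  proof (rule that[of "\<lambda>v. v \<in> A"], unfold proper_coloring_def, intro ballI allI impI)
    fix e u v assume "e \<in> edges H" "ends H e = {u, v}"
    then obtain a b where "a \<in> A" "b \<in> B" "{u, v} = {a, b}" using AB by metis
    then show "(u \<in> A) \<noteq> (v \<in> A)" using AB(2) by (auto simp: doubleton_eq_iff)
  qed
qed

text \<open>When two Barnette graphs arise, no thread joins their vertex sets, so their colourings
  can be glued.\<close>

lemma suppress_coloring:
  assumes "suppresses_to_two_barnette H \<or> suppresses_to_barnette_and_curve H"
  obtains c where "proper_coloring (suppress H) c"
  using assms
proof
  assume "suppresses_to_barnette_and_curve H"
  then have "bipartite (suppress H)"
    unfolding suppresses_to_barnette_and_curve_def barnette_def by blast
  then show thesis by (rule bipartite_coloring) (rule that)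
next
  assume "suppresses_to_two_barnette H"
  then obtain X Y where XY: "X \<inter> Y = {}"
      "\<forall>T\<in>edges (suppress H). ends (suppress H) T \<subseteq> X \<or> ends (suppress H) T \<subseteq> Y"
      "barnette (induced (suppress H) X)" "barnette (induced (suppress H) Y)"
    unfolding suppresses_to_two_barnette_def by blast
  obtain c1 where c1: "proper_coloring (induced (suppress H) X) c1"
    using XY(3) bipartite_coloring unfolding barnette_def by metis
  obtain c2 where c2: "proper_coloring (induced (suppress H) Y) c2"
    using XY(4) bipartite_coloring unfolding barnette_def by metis
  show thesis
  proof (rule that[of "\<lambda>v. if v \<in> X then c1 v else c2 v"], unfold proper_coloring_def, intro ballI allI impI)
    fix T u v assume T': "T \<in> edges (suppress H)" and e: "ends (suppress H) T = {u, v}"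
    then consider "{u, v} \<subseteq> X" | "{u, v} \<subseteq> Y" using XY(2) e by metis
    then show "(if u \<in> X then c1 u else c2 u) \<noteq> (if v \<in> X then c1 v else c2 v)"
    proof cases
      case 1
      then show ?thesis using proper_coloringD[OF c1, of T u v] T' e by (simp add: induced_def)
    next
      case 2
      then have "u \<notin> X" "v \<notin> X" using XY(1) by auto
      then show ?thesis using proper_coloringD[OF c2, of T u v] T' e 2 by (simp add: induced_def)
    qed
  qed
qed

section \<open>Emptying an annulus and comparing two colourings\<close>

locale annular_connected = annular_graph G pt cv C x
  for G :: "('v, 'e) mgraph" and pt cv C x +
  assumes ac: "k < x \<Longrightarrow> suppresses_to_two_barnette (del_edges G (annulus_edges G C (Suc k))) \<or>
      suppresses_to_barnette_and_curve (del_edges G (annulus_edges G C (Suc k)))"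
begin

abbreviation cut :: "nat \<Rightarrow> ('v, 'e) mgraph" where
  "cut k \<equiv> del_edges G (annulus_edges G C (Suc k))"

text \<open>By \<open>degree_cut\<close> these are exactly the vertices of \<open>G\<close> that are
  suppressed once the annulus is emptied.\<close>

definition cut_end :: "nat \<Rightarrow> 'v \<Rightarrow> bool" where
  "cut_end k v \<longleftrightarrow> (\<exists>e\<in>annulus_edges G C (Suc k). v \<in> ends G e)"

lemma cut_end_iff:
  assumes "k < x" "v \<in> VC j" "j \<le> x"
  shows "cut_end k v \<longleftrightarrow> j = k \<and> outward v \<or> j = Suc k \<and> \<not> outward v"
proof
  assume "cut_end k v"
  then obtain e where e: "e \<in> annulus_edges G C (Suc k)" "v \<in> ends G e" by (auto simp: cut_end_def)
  obtain a b where ab: "ends G e = {a, b}" "a \<in> VC k" "b \<in> VC (Suc k)" "outward a" "\<not> outward b"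
    using annulus_edge_ends[OF e(1) assms(1)] .
  have "v = a \<or> v = b" using e ab by auto
  then show "j = k \<and> outward v \<or> j = Suc k \<and> \<not> outward v"
  proof
    assume "v = a"
    then show ?thesis using VC_unique[of v j k] ab assms by simp
  next
    assume "v = b"
    then show ?thesis using VC_unique[of v j "Suc k"] ab assms by simp
  qed
next
  assume "j = k \<and> outward v \<or> j = Suc k \<and> \<not> outward v"
  then show "cut_end k v"
  proof
    assume *: "j = k \<and> outward v"
    obtain e u where "e \<in> annulus_edges G C (Suc j)" "ends G e = {v, u}"
      using outwardE[of v j] * assms by metis
    then show ?thesis using * by (auto simp: cut_end_def)
  next
    assume *: "j = Suc k \<and> \<not> outward v"
    obtain e u where "e \<in> annulus_edges G C j" "ends G e = {u, v}"
      using not_outwardE[of v j] * assms by metis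
    then show ?thesis using * by (auto simp: cut_end_def)
  qed
qed

lemma degree_cut:
  assumes "k < x" "v \<in> verts G"
  shows "degree (cut k) v = (if cut_end k v then 2 else 3)"
proof -
  have d: "degree (cut k) v = card ({e \<in> edges G. v \<in> ends G e} - annulus_edges G C (Suc k))"
  proof -
    have "{e \<in> edges (cut k). ends (cut k) e = {v}} = {}" using no_loop by (auto simp: del_edges_def)
    moreover have "{e \<in> edges (cut k). v \<in> ends (cut k) e} =
        {e \<in> edges G. v \<in> ends G e} - annulus_edges G C (Suc k)" by (auto simp: del_edges_def)
    ultimately show ?thesis by (simp only: degree_def card.empty add_0_right)
  qed
  show ?thesis
  proof (cases "cut_end k v")
    case True
    then obtain e where e: "e \<in> annulus_edges G C (Suc k)" "v \<in> ends G e" by (auto simp: cut_end_def)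
    obtain a b where ab: "ends G e = {a, b}" "a \<in> VC k" "b \<in> VC (Suc k)" "e \<in> edges G"
      using annulus_edge_ends[OF e(1) assms(1)] by metis
    have "f = e" if "f \<in> annulus_edges G C (Suc k)" "v \<in> ends G f" for f
    proof -
      have "v = a \<or> v = b" using e ab by auto
      then show ?thesis
        using outward_unique[of k v f e] inward_unique[of k v f e] that e ab assms(1) by blast
    qed
    then have "{e \<in> edges G. v \<in> ends G e} - annulus_edges G C (Suc k) = {e \<in> edges G. v \<in> ends G e} - {e}"
      using e ab by blast
    then show ?thesis using d degree_G[OF assms(2)] True e ab finite_edges by simp
  next
    case False
    then have "{e \<in> edges G. v \<in> ends G e} - annulus_edges G C (Suc k) = {e \<in> edges G. v \<in> ends G e}"
      by (auto simp: cut_end_def)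
    then show ?thesis using d degree_G[OF assms(2)] False by simp
  qed
qed

text \<open>\<open>c\<close> colours the graph and \<open>c'\<close> the suppressed cut graph; edges without suppressed ends
  make both change, so the two agree or disagree consistently along such edges.\<close>

lemma cut_coloring_edge:
  assumes k: "k < x"
    and c: "proper_coloring G c"
    and c': "proper_coloring (suppress (cut k)) c'"
    and e: "e \<in> edges G" "ends G e = {u, v}" and uv: "\<not> cut_end k u" "\<not> cut_end k v"
  shows "(c u = c' u) = (c v = c' v)"
proof -
  have "u \<in> verts G" "v \<in> verts G" using ends_verts e by auto
  then have deg: "degree (cut k) u \<noteq> 2" "degree (cut k) v \<noteq> 2" using degree_cut k uv by auto
  have "e \<notin> annulus_edges G C (Suc k)" using uv e by (auto simp: cut_end_def)
  then have E: "e \<in> edges (cut k)" "ends (cut k) e = {u, v}" using e by (auto simp: del_edges_def)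
  have t: "is_thread (cut k) {e}" "ends (suppress (cut k)) {e} = {u, v}"
    using thread_ends[of 1 "\<lambda>_. e" "cut k" "\<lambda>t. if t = 0 then u else v"] E deg by simp_all
  from t(1) have "{e} \<in> edges (suppress (cut k))" by (simp add: suppress_def)
  then have "c' u \<noteq> c' v" using proper_coloringD[OF c' _ t(2)] by blast
  then show ?thesis using proper_coloringD[OF c e] by blast
qed

text \<open>A cycle not bordering the emptied annulus has no suppressed vertex, so
  \<open>cut_coloring_edge\<close> applies to each of its edges.\<close>

lemma cut_coloring_cycle:
  assumes k: "k < x"
    and c: "proper_coloring G c"
    and c': "proper_coloring (suppress (cut k)) c'"
    and j: "j \<le> x" "j \<noteq> k" "j \<noteq> Suc k" and uv: "u \<in> VC j" "v \<in> VC j"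
  shows "(c u = c' u) = (c v = c' v)"
proof -
  let ?S = "{v. (c u = c' u) = (c v = c' v)}"
  have "VC j \<subseteq> ?S"
  proof (rule cycle_closed[OF simple C_cycle[OF j(1)]])
    show "?S \<inter> VC j \<noteq> {}" using uv by blast
    fix e assume e: "e \<in> C j" "ends G e \<inter> ?S \<noteq> {}"
    then have eG: "e \<in> edges G" using C_edges j by auto
    then obtain a b where ab: "ends G e = {a, b}" using ends_card by (metis card_2_iff)
    then have "a \<in> VC j" "b \<in> VC j" using C_ends[OF e(1)] ab by auto
    then have "\<not> cut_end k a" "\<not> cut_end k b" using cut_end_iff[OF k _ j(1)] j by auto
    then have "(c a = c' a) = (c b = c' b)" using cut_coloring_edge[OF k c c' eG ab] by blast
    then show "ends G e \<subseteq> ?S" using e ab by auto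
  qed
  then show ?thesis using uv by blast
qed

text \<open>The suppressed vertices strictly between \<open>w i\<close> and \<open>w (i + l)\<close>
  merge into a single edge. For \<open>l = n\<close> its two ends coincide, a loop that no proper
  colouring admits, so this case needs no separate treatment.\<close>

lemma cut_coloring_thread:
  assumes k: "k < x"
    and c': "proper_coloring (suppress (cut k)) c'"
    and j: "j \<le> x" and n: "0 < n"
    and w: "\<And>i j. w i = w j \<longleftrightarrow> i mod n = j mod n"
    and \<epsilon>: "\<And>i j. \<epsilon> i = \<epsilon> j \<longleftrightarrow> i mod n = j mod n"
    and E: "\<And>i. ends G (\<epsilon> i) = {w i, w (Suc i)}" "range \<epsilon> = C j" "range w = VC j"
    and l: "l \<le> n" "0 < l"
    and run: "\<And>t. i < t \<Longrightarrow> t < i + l \<Longrightarrow> cut_end k (w t)" "\<not> cut_end k (w i)" "\<not> cut_end k (w (i + l))"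
  shows "c' (w i) \<noteq> c' (w (i + l))"
proof -
  have V: "w t \<in> verts G" for t using E(3) j verts_eq by blast
  have A: "\<epsilon> t \<in> edges G" "\<epsilon> t \<notin> annulus_edges G C (Suc k)" for t
    using E(2) C_edges[OF j] annulus_edge_not_C[OF _ k j] by blast+
  \<comment> \<open>Any \<open>n\<close> consecutive indices are distinct modulo \<open>n\<close>;
    the window starts at 0 or 1 depending on which end of the thread is left out.\<close>
  have inj: "inj_on (\<lambda>t. (i + t) mod n) {a..<a + n}" for a
  proof (rule inj_onI)
    fix s t assume "s \<in> {a..<a + n}" "t \<in> {a..<a + n}" and eq: "(i + s) mod n = (i + t) mod n"
    then show "s = t"
    proof (induction s t rule: linorder_wlog)
      case (le s t)
      then have "n dvd (i + t) - (i + s)" by (metis mod_eq_dvd_iff_nat add_left_mono)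
      then have "n dvd t - s" by simp
      then show ?case using le by (auto dest: dvd_imp_le)
    next
      case (sym s t)
      then show ?case by simp
    qed
  qed
  have inj_w: "inj_on (\<lambda>t. w (i + t)) {a..<a + n}" for a
    using inj[of a] unfolding inj_on_def by (simp add: w)
  have inj_\<epsilon>: "inj_on (\<lambda>t. \<epsilon> (i + t)) {a..<a + n}" for a
    using inj[of a] unfolding inj_on_def by (simp add: \<epsilon>)
  have 1: "\<epsilon> (i + t) \<in> edges (cut k) \<and> ends (cut k) (\<epsilon> (i + t)) = {w (i + t), w (i + Suc t)}" for t
    using A[of "i + t"] E(1)[of "i + t"] by (simp add: del_edges_def)
  have 2: "inj_on (\<lambda>t. \<epsilon> (i + t)) {0..<l}" by (rule inj_on_subset[OF inj_\<epsilon>[of 0]]) (use l in auto)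
  have 3: "inj_on (\<lambda>t. w (i + t)) {0..<l}" by (rule inj_on_subset[OF inj_w[of 0]]) (use l in auto)
  have 4: "inj_on (\<lambda>t. w (i + t)) {Suc 0..l}" by (rule inj_on_subset[OF inj_w[of 1]]) (use l in auto)
  have 5: "degree (cut k) (w (i + t)) = 2" if "0 < t" "t < l" for t
    using degree_cut[OF k V] run(1)[of "i + t"] that by simp
  have 6: "degree (cut k) (w (i + 0)) \<noteq> 2" "degree (cut k) (w (i + l)) \<noteq> 2"
    using degree_cut[OF k V] run by simp_all
  have t: "is_thread (cut k) ((\<lambda>t. \<epsilon> (i + t)) ` {0..<l})"
    "ends (suppress (cut k)) ((\<lambda>t. \<epsilon> (i + t)) ` {0..<l}) = {w (i + 0), w (i + l)}"
    using thread_ends[OF l(2) 1 2 3 4 5 6] by blast+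
  from t(1) have "(\<lambda>t. \<epsilon> (i + t)) ` {0..<l} \<in> edges (suppress (cut k))" by (simp add: suppress_def)
  then show ?thesis using proper_coloringD[OF c' _ t(2)] by simp
qed

text \<open>The cycle is even, so its edges of either parity form a perfect matching. Since runs of
  equal kind are even, all edges joining vertices of different kinds have the same parity; the other
  parity is chosen.\<close>

lemma cycle_matching:
  assumes j: "j \<le> x"
  obtains M where "M \<subseteq> C j" "\<And>v. v \<in> VC j \<Longrightarrow> \<exists>!e. e \<in> M \<and> v \<in> ends G e"
    "\<And>e u v. e \<in> M \<Longrightarrow> u \<in> ends G e \<Longrightarrow> v \<in> ends G e \<Longrightarrow> outward u = outward v"
proof -
  obtain w \<epsilon> and n :: nat where n: "3 \<le> n"
    and w: "\<And>i j. w i = w j \<longleftrightarrow> i mod n = j mod n"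
    and \<epsilon>: "\<And>i j. \<epsilon> i = \<epsilon> j \<longleftrightarrow> i mod n = j mod n"
    and e: "\<And>i. ends G (\<epsilon> i) = {w i, w (Suc i)}"
    and C: "C j = range \<epsilon>" and V: "VC j = range w"
    by (rule is_cycleE[OF simple C_cycle[OF j]]) blast
  obtain c where c: "proper_coloring G c"
    by (rule bipartite_coloring[OF bip]) blast
  have c_step: "c (w (Suc i)) = (\<not> c (w i))" for i
    using proper_coloringD[OF c, of "\<epsilon> i" "w i" "w (Suc i)"] e C C_edges[OF j] by blast
  have c_alt: "c (w (i + t)) = (c (w i) = even t)" for i t
    by (induction t) (auto simp: c_step)
  have "w (0 + n) = w 0" by (simp add: w)
  then have even_n: "even n" using c_alt[of 0 n] by metis
  define turn where "turn i \<longleftrightarrow> outward (w i) \<noteq> outward (w (Suc i))" for i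
  have wV: "w i \<in> VC j" for i using V by blast
  \<comment> \<open>Emptying the annulus that holds the third edges of the run turns the run and its
    two bounding vertices into one thread, so \<open>c'\<close> differs at the bounding vertices.
    Their third edges lead to the cycle on the other side, where nothing is suppressed, so
    \<open>c\<close> agrees with \<open>c'\<close> at both or at neither. Hence \<open>c\<close>
    differs as well, and the thread has odd length.\<close>
  have run_even: "even (i' - i)"
    if i: "turn i" "turn i'" "i < i'" and no: "\<And>t. i < t \<Longrightarrow> t < i' \<Longrightarrow> \<not> turn t" for i i'
  proof -
    define s where "s = outward (w (Suc i))"
    have run: "outward (w t) = s" if t: "i < t" "t \<le> i'" for t
      using t
    proof (induction t)
      case (Suc t)
      then show ?case using no[of t] by (cases "t = i") (auto simp: s_def turn_def)
    qed simp
    have i0: "outward (w i) = (\<not> s)" using i(1) s_def turn_def by auto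
    have i1: "outward (w (Suc i')) = (\<not> s)" using i(2) run[of i'] i(3) turn_def by auto
    have "w (i + n) = w i" by (simp add: w)
    \<comment> \<open>Otherwise the run would return to \<open>w i\<close>, which is of the other
      kind.\<close>
    then have "i' < i + n" using run[of "i + n"] i0 n by fastforce
    \<comment> \<open>The number of edges of the thread, one more than the number
      \<open>i' - i\<close> of vertices in the run.\<close>
    define l where "l = Suc i' - i"
    have l: "l \<le> n" "0 < l" "i + l = Suc i'" using \<open>i' < i + n\<close> i(3) by (auto simp: l_def)
    \<comment> \<open>Both kinds occur on \<open>C j\<close>, so there is an annulus on each side of
      it.\<close>
    obtain z where "w z \<in> VC j" "outward (w z)" using i0 run[of "Suc i"] i(3) wV by (cases s) auto
    then have jx: "j < x" using outwardE j by metis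
    obtain z where "w z \<in> VC j" "\<not> outward (w z)" using i0 run[of "Suc i"] i(3) wV by (cases s) auto
    then obtain j0 where j0: "j = Suc j0" using not_outwardE j by metis
    \<comment> \<open>\<open>cut k\<close> empties the annulus between \<open>C k\<close> and
      \<open>C (Suc k)\<close>, which is the one on the side to which vertices of kind
      \<open>s\<close> point.\<close>
    define k where "k = (if s then j else j0)"
    have k: "k < x" using jx j0 k_def by auto
    have cut: "cut_end k (w t) \<longleftrightarrow> outward (w t) = s" for t
      using cut_end_iff[OF k wV j] j0 k_def by auto
    obtain c' where c': "proper_coloring (suppress (cut k)) c'"
      using suppress_coloring[OF ac[OF k]] by blast
    have "c' (w i) \<noteq> c' (w (i + l))"
    proof (rule cut_coloring_thread[OF k c' j _ w \<epsilon> e C[symmetric] V[symmetric] l(1,2)])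
      show "0 < n" using n by simp
      show "cut_end k (w t)" if "i < t" "t < i + l" for t using that l(3) cut run by simp
      show "\<not> cut_end k (w i)" "\<not> cut_end k (w (i + l))" using cut i0 i1 l(3) by auto
    qed
    moreover have "(c (w i) = c' (w i)) = (c (w (i + l)) = c' (w (i + l)))"
    proof -
      \<comment> \<open>The neighbouring cycle of \<open>C j\<close> on the side that is not cut;
        the bounding vertices of the run point to it.\<close>
      define j' where "j' = (if s then j0 else Suc j)"
      have j': "j' \<le> x" "j' \<noteq> k" "j' \<noteq> Suc k" using j0 jx k_def j'_def by auto
      have nbr: "\<exists>f y. f \<in> edges G \<and> ends G f = {w t, y} \<and> y \<in> VC j'" if "outward (w t) = (\<not> s)" for t
      proof (cases s)
        case True
        then obtain i e v where "j = Suc i" "ends G e = {v, w t}" "v \<in> VC i" "e \<in> edges G"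
          using not_outwardE[OF _ wV j] \<open>outward (w t) = (\<not> s)\<close> by metis
        then show ?thesis using True j0 j'_def by (auto simp: insert_commute)
      next
        case False
        then obtain e u where "ends G e = {w t, u}" "u \<in> VC (Suc j)" "e \<in> edges G"
          using outwardE[OF _ wV j] \<open>outward (w t) = (\<not> s)\<close> by metis
        then show ?thesis using False j'_def by auto
      qed
      have nc: "\<not> cut_end k y" if "y \<in> VC j'" for y
        using cut_end_iff[OF k that j'(1)] j' by auto
      obtain f y where f: "f \<in> edges G" "ends G f = {w i, y}" "y \<in> VC j'" using nbr[OF i0] by blast
      obtain f' y' where f': "f' \<in> edges G" "ends G f' = {w (i + l), y'}" "y' \<in> VC j'"
        using nbr[OF i1] l(3) by auto
      have "(c (w i) = c' (w i)) = (c y = c' y)"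
        using cut_coloring_edge[OF k c c' f(1,2)] cut i0 nc[OF f(3)] by auto
      moreover have "(c y = c' y) = (c y' = c' y')"
        using cut_coloring_cycle[OF k c c' j' f(3) f'(3)] .
      moreover have "(c (w (i + l)) = c' (w (i + l))) = (c y' = c' y')"
        using cut_coloring_edge[OF k c c' f'(1,2)] cut i1 l(3) nc[OF f'(3)] by auto
      ultimately show ?thesis by simp
    qed
    ultimately have "c (w (i + l)) \<noteq> c (w i)" by blast
    then have "odd l" using c_alt[of i l] by blast
    then show ?thesis using l(3) i(3) by (auto simp: l_def Suc_diff_le)
  qed
  have turns_even: "even (i' - i)" if "turn i" "turn i'" "i < i'" for i i'
    using that
  proof (induction "i' - i" arbitrary: i i' rule: less_induct)
    case less
    show ?case
    proof (cases "\<exists>t. i < t \<and> t < i' \<and> turn t")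
      case True
      then obtain t where t: "i < t" "t < i'" "turn t" by blast
      then have "even (t - i)" "even (i' - t)" using less by auto
      moreover have "i' - i = (t - i) + (i' - t)" using t by simp
      ultimately show ?thesis by simp
    next
      case False
      then show ?thesis using run_even less by blast
    qed
  qed
  \<comment> \<open>The edge \<open>\<epsilon> i\<close> joins different kinds exactly if
    \<open>turn i\<close>. Turns share one parity and \<open>b\<close> selects the other; without
    turns either choice will do.\<close>
  obtain b where b: "\<And>i. turn i \<Longrightarrow> even i \<noteq> b"
  proof (cases "\<exists>i. turn i")
    case True
    then obtain i0 where i0: "turn i0" by blast
    have "even i = even i0" if "turn i" for i
    proof (cases i i0 rule: linorder_cases)
      case less
      then show ?thesis using turns_even[OF that i0] by (simp add: even_diff_nat)
    next
      case greater
      then show ?thesis using turns_even[OF i0 that] by (simp add: even_diff_nat)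
    qed simp
    then show thesis using that[of "odd i0"] by auto
  qed (use that in blast)
  \<comment> \<open>Because \<open>n\<close> is even, the parity of an index depends only on the
    edge it names.\<close>
  have even_mod: "even i = even j" if "i mod n = j mod n" for i j
    using that even_n by (metis dvd_mod_iff)
  define M where "M = {\<epsilon> t |t. even t = b}"
  have M_iff: "\<epsilon> t \<in> M \<longleftrightarrow> even t = b" for t
  proof
    assume "\<epsilon> t \<in> M"
    then obtain t' where "\<epsilon> t = \<epsilon> t'" "even t' = b" unfolding M_def by blast
    then show "even t = b" using even_mod \<epsilon> by blast
  qed (auto simp: M_def)
  show thesis
  proof (rule that[of M])
    show "M \<subseteq> C j" unfolding M_def C by auto
    show "outward u = outward v" if "f \<in> M" "u \<in> ends G f" "v \<in> ends G f" for f u v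
    proof -
      obtain t where "f = \<epsilon> t" "even t = b" using \<open>f \<in> M\<close> unfolding M_def by blast
      then have "\<not> turn t" using b by blast
      then show ?thesis using that e[of t] \<open>f = \<epsilon> t\<close> unfolding turn_def by auto
    qed
    fix v assume "v \<in> VC j"
    then obtain i0 where "v = w i0" using V by auto
    moreover have "w i0 = w (Suc (i0 + n - 1))" using n by (simp add: w)
    ultimately obtain i where v: "v = w (Suc i)" by metis
    have inc: "v \<in> ends G (\<epsilon> t) \<longleftrightarrow> \<epsilon> t = \<epsilon> i \<or> \<epsilon> t = \<epsilon> (Suc i)" for t
    proof -
      have "Suc i mod n = Suc t mod n \<longleftrightarrow> i mod n = t mod n"
        using n by (auto simp: mod_Suc split: if_splits)
      then have "w (Suc i) = w (Suc t) \<longleftrightarrow> \<epsilon> t = \<epsilon> i"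
        using w[of "Suc i" "Suc t"] \<epsilon>[of t i] by metis
      moreover have "w (Suc i) = w t \<longleftrightarrow> \<epsilon> t = \<epsilon> (Suc i)"
        using w[of "Suc i" t] \<epsilon>[of t "Suc i"] by metis
      ultimately show ?thesis unfolding v using e[of t] by auto
    qed
    define t0 where "t0 = (if even i = b then i else Suc i)"
    have "even t0 = b" unfolding t0_def by auto
    show "\<exists>!f. f \<in> M \<and> v \<in> ends G f"
    proof (rule ex1I[of _ "\<epsilon> t0"])
      have "t0 = i \<or> t0 = Suc i" unfolding t0_def by simp
      then show "\<epsilon> t0 \<in> M \<and> v \<in> ends G (\<epsilon> t0)"
        using \<open>even t0 = b\<close> M_iff[of t0] inc[of t0] by blast
      fix f assume f: "f \<in> M \<and> v \<in> ends G f"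
      then obtain t where t: "f = \<epsilon> t" "even t = b" unfolding M_def by blast
      then have "\<epsilon> t = \<epsilon> i \<or> \<epsilon> t = \<epsilon> (Suc i)" using f inc by blast
      then show "f = \<epsilon> t0"
      proof
        assume eq: "\<epsilon> t = \<epsilon> i"
        then have "even i = b" using M_iff[of i] M_iff[of t] t(2) by simp
        then have "t0 = i" unfolding t0_def by (rule if_P)
        then show ?thesis using t(1) eq by simp
      next
        assume eq: "\<epsilon> t = \<epsilon> (Suc i)"
        then have "even (Suc i) = b" using M_iff[of "Suc i"] M_iff[of t] t(2) by simp
        then have "\<not> (even i = b)" using even_Suc[of i] by blast
        then have "t0 = Suc i" unfolding t0_def by (rule if_not_P)
        then show ?thesis using t(1) eq by simp
      qed
    qed
  qed
qed

end

section \<open>Extending the Hamiltonian cycle across an annulus\<close>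

text \<open>Induction with \<open>cycle_replace_edge\<close>. Replacement paths meet each other only
  on the original cycle, so each still meets the modified cycle just in the ends of its edge; as
  they contain no edge of \<open>F\<close>, none brings back an edge of \<open>Q\<close>.\<close>

lemma cycle_replace_edges:
  assumes G: "simple_graph G" and F: "is_cycle G F" and fin: "finite Q" and QF: "Q \<subseteq> F"
    and p: "\<And>q. q \<in> Q \<Longrightarrow> gpath G (us q) (fs q)"
    and ends: "\<And>q. q \<in> Q \<Longrightarrow> ends G q = {hd (us q), last (us q)}"
    and len: "\<And>q. q \<in> Q \<Longrightarrow> 2 \<le> length (fs q)"
    and int: "\<And>q. q \<in> Q \<Longrightarrow> set (us q) \<inter> vertices_on G F = ends G q"
    and new: "\<And>q. q \<in> Q \<Longrightarrow> set (fs q) \<inter> F = {}"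
    and disj: "\<And>q q'. q \<in> Q \<Longrightarrow> q' \<in> Q \<Longrightarrow> q \<noteq> q' \<Longrightarrow> set (us q) \<inter> set (us q') \<subseteq> vertices_on G F"
  shows "is_cycle G (F - Q \<union> (\<Union>q\<in>Q. set (fs q))) \<and>
    vertices_on G (F - Q \<union> (\<Union>q\<in>Q. set (fs q))) = vertices_on G F \<union> (\<Union>q\<in>Q. set (us q))"
  using fin QF p ends len int new disj
proof (induction Q rule: finite_induct)
  case empty
  then show ?case using F by simp
next
  case (insert q Q)
  let ?F = "F - Q \<union> (\<Union>q\<in>Q. set (fs q))"
  have IH: "is_cycle G ?F" "vertices_on G ?F = vertices_on G F \<union> (\<Union>q\<in>Q. set (us q))"
  proof -
    have "is_cycle G ?F \<and> vertices_on G ?F = vertices_on G F \<union> (\<Union>q\<in>Q. set (us q))"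
    proof (rule insert.IH)
      show "Q \<subseteq> F" using insert.prems(1) by simp
      fix r assume "r \<in> Q"
      then have r: "r \<in> insert q Q" by simp
      show "gpath G (us r) (fs r)" "ends G r = {hd (us r), last (us r)}" "2 \<le> length (fs r)"
        "set (us r) \<inter> vertices_on G F = ends G r" "set (fs r) \<inter> F = {}"
        by (rule insert.prems(2-6)[OF r])+
      fix r' assume "r' \<in> Q" "r \<noteq> r'"
      then show "set (us r) \<inter> set (us r') \<subseteq> vertices_on G F" using insert.prems(7)[OF r] by simp
    qed
    then show "is_cycle G ?F" "vertices_on G ?F = vertices_on G F \<union> (\<Union>q\<in>Q. set (us q))"
      by simp_all
  qed
  have q: "q \<in> ?F" using insert.hyps insert.prems by auto
  have "set (us q) \<inter> vertices_on G ?F = ends G q"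
  proof -
    have "set (us q) \<inter> (\<Union>q'\<in>Q. set (us q')) \<subseteq> vertices_on G F"
    proof (rule subsetI, elim IntE UN_E)
      fix v r assume v: "v \<in> set (us q)" "r \<in> Q" "v \<in> set (us r)"
      then have "q \<noteq> r" using insert.hyps(2) by blast
      then show "v \<in> vertices_on G F" using insert.prems(7)[of q r] v by auto
    qed
    moreover have "set (us q) \<inter> vertices_on G F = ends G q" by (rule insert.prems(5)) simp
    ultimately show ?thesis unfolding IH(2) by blast
  qed
  then have "is_cycle G (?F - {q} \<union> set (fs q))"
      "vertices_on G (?F - {q} \<union> set (fs q)) = vertices_on G ?F \<union> set (us q)"
    using cycle_replace_edge[OF G IH(1) q, of "us q" "fs q"] insert.prems(2-4)[of q] by auto
  moreover have "?F - {q} \<union> set (fs q) = F - insert q Q \<union> (\<Union>q\<in>insert q Q. set (fs q))"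
  proof -
    have "q \<notin> set (fs r)" if "r \<in> Q" for r
      using insert.prems(1) insert.prems(6)[of r] that by auto
    then show ?thesis by auto
  qed
  ultimately show ?case using IH(2) by auto
qed

context annular_connected
begin

section \<open>Detours across an annulus\<close>

text \<open>The path \<open>a # vs @ [b]\<close> with edges \<open>e # es @ [e']\<close> is meant to
  replace \<open>q\<close>. Which of the two arcs of \<open>C (Suc k)\<close> is taken is left open,
  so that both cases of the induction step can use the same notion.\<close>

definition detour :: "nat \<Rightarrow> 'e \<Rightarrow> 'v \<Rightarrow> 'v \<Rightarrow> 'e \<Rightarrow> 'e \<Rightarrow> 'v list \<Rightarrow> 'e list \<Rightarrow> bool" where
  "detour k q a b e e' vs es \<longleftrightarrow> ends G q = {a, b} \<and> a \<noteq> b \<and> a \<in> VC k \<and> b \<in> VC k \<and>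
     e \<in> annulus_edges G C (Suc k) \<and> ends G e = {a, hd vs} \<and>
     e' \<in> annulus_edges G C (Suc k) \<and> ends G e' = {b, last vs} \<and>
     gpath G vs es \<and> set es \<subseteq> C (Suc k) \<and> hd vs \<noteq> last vs \<and> \<not> outward (hd vs) \<and> \<not> outward (last vs)"

lemma detour_path:
  assumes d: "detour k q a b e e' vs es" and k: "k < x"
  shows "gpath G (a # vs @ [b]) (e # es @ [e'])" "vertices_on G (set es) = set vs"
    "set vs \<subseteq> VC (Suc k)" "hd vs \<in> set vs" "last vs \<in> set vs" "a \<notin> VC (Suc k)" "b \<notin> VC (Suc k)"
proof -
  note d = d[unfolded detour_def]
  have p: "gpath G vs es" and "vs \<noteq> []" using d gpath_nonempty by auto
  have "es \<noteq> []"
  proof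
    assume "es = []"
    then obtain v where "vs = [v]" using gpath_length[OF p] by (cases vs) auto
    then show False using d by simp
  qed
  then show V: "vertices_on G (set es) = set vs" using gpath_vertices_on_eq[OF p] by simp
  show sub: "set vs \<subseteq> VC (Suc k)"
    unfolding V[symmetric] using d by (auto simp: vertices_on_def)
  show "hd vs \<in> set vs" "last vs \<in> set vs" using \<open>vs \<noteq> []\<close> by simp_all
  show ab: "a \<notin> VC (Suc k)" "b \<notin> VC (Suc k)"
    using d VC_disjoint[of k "Suc k"] k by auto
  have eG: "e \<in> edges G" "e' \<in> edges G" using d by (auto elim: annulus_edgeE)
  obtain c cs where vs: "vs = c # cs" using \<open>vs \<noteq> []\<close> by (cases vs) auto
  have 1: "gpath G (a # vs) (e # es)" using d eG sub ab p vs by auto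
  obtain ds z where vz: "vs = ds @ [z]" using \<open>vs \<noteq> []\<close> by (cases vs rule: rev_exhaust) auto
  have 2: "gpath G [z, b] [e']" using d eG sub ab vz by (auto simp: insert_commute)
  have "gpath G ((a # ds) @ z # [b]) ((e # es) @ [e'])"
  proof (rule gpath_append[OF _ 2])
    show "gpath G ((a # ds) @ [z]) (e # es)" using 1 vz by simp
    have "a \<noteq> z" using ab sub vz by auto
    moreover have "distinct vs" by (rule gpath_distinct[OF p])
    ultimately show "set (a # ds) \<inter> set [z, b] = {}" using d ab sub vz by auto
  qed
  then show "gpath G (a # vs @ [b]) (e # es @ [e'])" using vz by simp
qed

lemma mates:
  assumes k: "k < x" and q: "q \<in> C k" "ends G q = {a, b}" "outward a" "outward b"
  obtains e e' p p' where "a \<noteq> b" "a \<in> VC k" "b \<in> VC k"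
    "e \<in> annulus_edges G C (Suc k)" "ends G e = {a, p}" "e' \<in> annulus_edges G C (Suc k)" "ends G e' = {b, p'}"
    "p \<noteq> p'" "p \<in> VC (Suc k)" "p' \<in> VC (Suc k)" "\<not> outward p" "\<not> outward p'" "e \<in> edges G" "e' \<in> edges G"
proof -
  have kx: "k \<le> x" using k by simp
  have ab: "a \<in> VC k" "b \<in> VC k" using C_ends[OF q(1)] q by auto
  have "q \<in> edges G" using q(1) C_edges[OF kx] by auto
  then have "a \<noteq> b" using ends_card q(2) by force
  obtain e p where e: "e \<in> annulus_edges G C (Suc k)" "ends G e = {a, p}" "p \<in> VC (Suc k)"
      "\<not> outward p" "e \<in> edges G"
    using outwardE[OF q(3) ab(1) kx] by metis
  obtain e' p' where e': "e' \<in> annulus_edges G C (Suc k)" "ends G e' = {b, p'}" "p' \<in> VC (Suc k)"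
      "\<not> outward p'" "e' \<in> edges G"
    using outwardE[OF q(4) ab(2) kx] by metis
  have "p \<noteq> p'"
  proof
    assume "p = p'"
    then have "e = e'" using inward_unique[of k p e e'] k e e' by auto
    then have "b = a \<or> b = p" using e e' by auto
    then show False using \<open>a \<noteq> b\<close> e q by auto
  qed
  then show thesis using that \<open>a \<noteq> b\<close> ab e e' by blast
qed

text \<open>If both arcs between \<open>p\<close> and \<open>p'\<close> had an inward vertex inside,
  the annulus edges at these two vertices would contradict
  \<open>annulus_noncrossing\<close>.\<close>

lemma inward_free_arc:
  assumes k: "k < x" and q: "q \<in> C k" "ends G q = {a, b}"
    and e: "e \<in> annulus_edges G C (Suc k)" "ends G e = {a, p}"
    and e': "e' \<in> annulus_edges G C (Suc k)" "ends G e' = {b, p'}"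
    and p: "p \<in> VC (Suc k)" "p' \<in> VC (Suc k)" "p \<noteq> p'"
  obtains vs es where "gpath G vs es" "hd vs = p" "last vs = p'" "set es \<subseteq> C (Suc k)"
    "\<forall>v\<in>set vs - {p, p'}. outward v"
proof -
  have kx: "k \<le> x" "Suc k \<le> x" using k by auto
  have ab: "a \<in> VC k" "b \<in> VC k" using C_ends[OF q(1)] q by auto
  obtain vs1 es1 vs2 es2 where s: "gpath G vs1 es1" "gpath G vs2 es2"
    "hd vs1 = p" "last vs1 = p'" "hd vs2 = p" "last vs2 = p'"
    "set es1 \<union> set es2 = C (Suc k)" "set es1 \<inter> set es2 = {}"
    "set vs1 \<inter> set vs2 = {p, p'}" "set vs1 \<union> set vs2 = VC (Suc k)"
    by (rule cycle_split[OF simple C_cycle[OF kx(2)] p])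
  show thesis
  proof (cases "(\<forall>v\<in>set vs1 - {p, p'}. outward v) \<or> (\<forall>v\<in>set vs2 - {p, p'}. outward v)")
    case True
    then show thesis
    proof
      assume "\<forall>v\<in>set vs1 - {p, p'}. outward v"
      then show thesis using that[of vs1 es1] s by blast
    next
      assume "\<forall>v\<in>set vs2 - {p, p'}. outward v"
      then show thesis using that[of vs2 es2] s by blast
    qed
  next
    case False
    then obtain i1 i2 where i: "i1 \<in> set vs1 - {p, p'}" "\<not> outward i1" "i2 \<in> set vs2 - {p, p'}" "\<not> outward i2"
      by blast
    \<comment> \<open>The edge from \<open>i\<close> to \<open>C k\<close> avoids \<open>a\<close>
      and \<open>b\<close>, whose only edges in this annulus are \<open>e\<close> and
      \<open>e'\<close>.\<close>
    have mate: "\<exists>f o'. f \<in> edges G \<and> ends G f = {o', i} \<and> o' \<in> VC k \<and> o' \<noteq> a \<and> o' \<noteq> b"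
      if "i \<in> VC (Suc k)" "\<not> outward i" "i \<notin> {p, p'}" for i
    proof -
      obtain j f v where j: "Suc k = Suc j" and f0: "f \<in> annulus_edges G C (Suc k)" "ends G f = {v, i}" "v \<in> VC j" "f \<in> edges G"
        using not_outwardE[OF \<open>\<not> outward i\<close> \<open>i \<in> VC (Suc k)\<close> kx(2)] by metis
      have f: "f \<in> annulus_edges G C (Suc k)" "ends G f = {v, i}" "v \<in> VC k" "f \<in> edges G"
        using f0 j by auto
      have "i \<notin> VC k" using VC_disjoint[of k "Suc k"] kx \<open>i \<in> VC (Suc k)\<close> by auto
      then have "i \<noteq> a" "i \<noteq> b" using ab by auto
      have "v \<noteq> a"
      proof
        assume "v = a"
        then have "f = e" using outward_unique[of k a f e] k ab f e by auto
        then have "i = a \<or> i = p" using f e by auto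
        then show False using \<open>i \<noteq> a\<close> \<open>i \<notin> {p, p'}\<close> by auto
      qed
      moreover have "v \<noteq> b"
      proof
        assume "v = b"
        then have "f = e'" using outward_unique[of k b f e'] k ab f e' by auto
        then have "i = b \<or> i = p'" using f e' by auto
        then show False using \<open>i \<noteq> b\<close> \<open>i \<notin> {p, p'}\<close> by auto
      qed
      ultimately show ?thesis using f by blast
    qed
    obtain f1 o1 where f1: "f1 \<in> edges G" "ends G f1 = {o1, i1}" "o1 \<in> VC k" "o1 \<noteq> a" "o1 \<noteq> b"
      using mate[of i1] i s(10) by blast
    obtain f2 o2 where f2: "f2 \<in> edges G" "ends G f2 = {o2, i2}" "o2 \<in> VC k" "o2 \<noteq> a" "o2 \<noteq> b"
      using mate[of i2] i s(10) by blast
    have eG: "e \<in> edges G" "e' \<in> edges G" using e e' by (auto elim: annulus_edgeE)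
    have "False"
      using annulus_noncrossing[OF C_cycle[OF kx(1)] C_cycle[OF kx(2)] VC_disjoint[OF kx] C_inside[OF k]
          q eG(1) e(2) eG(2) e'(2) s(1,3,4) s(2,5,6) s(7,8,9) p(3) f1 i(1) f2 i(3)] by simp
    then show thesis ..
  qed
qed

lemma VC_Suc_disjoint:
  assumes "k < x"
  shows "VC (Suc k) \<inter> (\<Union>i\<le>k. VC i) = {}"
proof -
  have "VC (Suc k) \<inter> VC i = {}" if "i \<le> k" for i
    using VC_disjoint[of "Suc k" i] assms that by simp
  then show ?thesis by blast
qed

section \<open>The induction over the cycles\<close>

text \<open>The induction invariant. Its last clause guarantees that the matching edges of
  \<open>C k\<close> with outward ends lie on \<open>F\<close> and so can be replaced by detours
  into the next annulus.\<close>

definition spanning_cycle :: "nat \<Rightarrow> 'e set \<Rightarrow> bool" where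
  "spanning_cycle k F \<longleftrightarrow> is_cycle G F \<and> vertices_on G F = (\<Union>i\<le>k. VC i) \<and>
     (\<forall>e\<in>C k. (\<exists>v\<in>ends G e. outward v) \<longrightarrow> e \<in> F)"

text \<open>One detour along all of \<open>C (Suc k)\<close> except \<open>f\<close> already
  collects every new vertex. The invariant survives because both ends of the omitted edge are
  inward.\<close>

lemma spanning_cycle_Suc_ladder:
  assumes F: "spanning_cycle k F" and k: "k < x" and d: "detour k q a b e e' vs es" and q: "q \<in> F"
    and f: "set es = C (Suc k) - {f}" "set vs = VC (Suc k)" "ends G f = {hd vs, last vs}"
  shows "spanning_cycle (Suc k) (F - {q} \<union> set (e # es @ [e']))"
proof -
  note F = F[unfolded spanning_cycle_def] and dp = detour_path[OF d k]
  note d = d[unfolded detour_def]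
  have int: "set (a # vs @ [b]) \<inter> vertices_on G F = ends G q"
    using F f(2) d VC_Suc_disjoint[OF k] by auto
  note r = cycle_replace_edge[OF simple _ q dp(1) _ int]
  have h: "ends G q = {hd (a # vs @ [b]), last (a # vs @ [b])}" using d by simp
  have "is_cycle G (F - {q} \<union> set (e # es @ [e']))"
    "vertices_on G (F - {q} \<union> set (e # es @ [e'])) = vertices_on G F \<union> set (a # vs @ [b])"
    using r F h by simp_all
  moreover have "vertices_on G F \<union> set (a # vs @ [b]) = (\<Union>i\<le>Suc k. VC i)"
    using F f(2) d by (auto simp: atMost_Suc)
  moreover have "g \<in> set es" if "g \<in> C (Suc k)" "v \<in> ends G g" "outward v" for g v
    using that f d by auto
  ultimately show ?thesis unfolding spanning_cycle_def by auto
qed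

text \<open>Two cycle edges at \<open>v\<close> lie on the arc by \<open>gpath_interior\<close>, and
  the cycle has no others there.\<close>

lemma detour_incident:
  assumes d: "detour k q a b e e' vs es" and k: "k < x"
    and v: "v \<in> set vs" "v \<noteq> hd vs" "v \<noteq> last vs" and g: "g \<in> C (Suc k)" "v \<in> ends G g"
  shows "g \<in> set es"
proof -
  have p: "gpath G vs es" and es: "set es \<subseteq> C (Suc k)" using d unfolding detour_def by auto
  have c: "card {e \<in> C (Suc k). v \<in> ends G e} = 2"
  proof (rule cycle_incident[OF simple C_cycle])
    show "Suc k \<le> x" using k by simp
    show "v \<in> VC (Suc k)" using detour_path(3)[OF d k] v(1) by blast
  qed
  then have "finite {e \<in> C (Suc k). v \<in> ends G e}" by (intro card_ge_0_finite) simp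
  then have "{e \<in> set es. v \<in> ends G e} = {e \<in> C (Suc k). v \<in> ends G e}"
    using gpath_interior[OF p v] c es by (intro card_seteq) auto
  then show ?thesis using g by blast
qed

text \<open>A common inward vertex must be an end of both arcs, so its unique edge to
  \<open>C k\<close> leads to an end of \<open>q\<close> and to an end of \<open>q'\<close>.\<close>

lemma detours_meet:
  assumes k: "k < x" and d: "detour k q a b e e' vs es" and d': "detour k q' a' b' f f' vs' es'"
    and v: "v \<in> set vs" "v \<in> set vs'" "\<not> outward v"
    and o: "\<forall>v\<in>set vs - {hd vs, last vs}. outward v" "\<forall>v\<in>set vs' - {hd vs', last vs'}. outward v"
  shows "ends G q \<inter> ends G q' \<noteq> {}"
proof -
  note D = d[unfolded detour_def] and D' = d'[unfolded detour_def]
  note p = detour_path[OF d k] and p' = detour_path[OF d' k]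
  have vV: "v \<in> VC (Suc k)" using v p by auto
  obtain g y where g: "g \<in> annulus_edges G C (Suc k)" "ends G g = {y, v}" "y \<in> ends G q"
  proof -
    have "v = hd vs \<or> v = last vs" using v o(1) by blast
    then show thesis using that[of e a] that[of e' b] D by auto
  qed
  obtain g' y' where g': "g' \<in> annulus_edges G C (Suc k)" "ends G g' = {y', v}" "y' \<in> ends G q'"
  proof -
    have "v = hd vs' \<or> v = last vs'" using v o(2) by blast
    then show thesis using that[of f a'] that[of f' b'] D' by auto
  qed
  have "g = g'" using inward_unique[of k v g g'] k vV g g' by auto
  moreover have "v \<noteq> y" using vV p(6,7) g(3) D by auto
  ultimately have "y = y'" using g g' by (auto simp: doubleton_eq_iff)
  then show ?thesis using g g' by blast
qed

lemma spanning_cycle_Suc: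
  assumes F: "spanning_cycle k F" and k: "k < x"
  shows "\<exists>F'. spanning_cycle (Suc k) F'"
proof -
  have kx: "k \<le> x" "Suc k \<le> x" using k by auto
  obtain M where M: "M \<subseteq> C k" "\<And>v. v \<in> VC k \<Longrightarrow> \<exists>!e. e \<in> M \<and> v \<in> ends G e"
    "\<And>e u v. e \<in> M \<Longrightarrow> u \<in> ends G e \<Longrightarrow> v \<in> ends G e \<Longrightarrow> outward u = outward v"
    using cycle_matching[OF kx(1)] by blast
  obtain M' where M': "M' \<subseteq> C (Suc k)" "\<And>v. v \<in> VC (Suc k) \<Longrightarrow> \<exists>!e. e \<in> M' \<and> v \<in> ends G e"
    "\<And>e u v. e \<in> M' \<Longrightarrow> u \<in> ends G e \<Longrightarrow> v \<in> ends G e \<Longrightarrow> outward u = outward v"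
    using cycle_matching[OF kx(2)] by blast
  define Q where "Q = {q \<in> M. \<exists>v\<in>ends G q. outward v}"
  note F' = F[unfolded spanning_cycle_def]
  have QC: "Q \<subseteq> C k" and QF: "Q \<subseteq> F" using M(1) F' unfolding Q_def by auto
  have Qout: "outward v" if "q \<in> Q" "v \<in> ends G q" for q v using that M(3) unfolding Q_def by blast
  have Qends: "\<exists>a b. ends G q = {a, b}" if "q \<in> Q" for q
    using that QC C_edges[OF kx(1)] ends_card by (metis card_2_iff subsetD)
  have Qdisj: "ends G q \<inter> ends G q' = {}" if "q \<in> Q" "q' \<in> Q" "q \<noteq> q'" for q q'
  proof -
    have "q \<in> M" "q' \<in> M" using that Q_def by auto
    moreover have "ends G q \<subseteq> VC k" using that QC C_ends by blast
    ultimately show ?thesis using M(2) that by blast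
  qed
  have Qcover: "\<exists>q\<in>Q. v \<in> ends G q" if "v \<in> VC k" "outward v" for v
    using M(2)[OF that(1)] that(2) unfolding Q_def by blast
  show ?thesis
  proof (cases "\<exists>q\<in>Q. \<exists>a b e e' vs es f. detour k q a b e e' vs es \<and> f \<in> C (Suc k) \<and> ends G f = {hd vs, last vs}")
    case True
    then obtain q a b e e' vs0 es0 f where q: "q \<in> Q" and d: "detour k q a b e e' vs0 es0"
      and f: "f \<in> C (Suc k)" "ends G f = {hd vs0, last vs0}"
      by blast
    \<comment> \<open>The given arc only records where the annulus edges end; the detour actually
      taken is the complement of \<open>f\<close>.\<close>
    obtain vs es where p: "gpath G vs es" "set es = C (Suc k) - {f}" "ends G f = {hd vs, last vs}"
        "set vs = VC (Suc k)"
      by (rule cycle_path[OF simple C_cycle[OF kx(2)] f(1)])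
    note D = d[unfolded detour_def]
    have "hd vs \<noteq> last vs" using f(2) p(3) D by (auto simp: doubleton_eq_iff)
    have "hd vs = hd vs0 \<and> last vs = last vs0 \<or> hd vs = last vs0 \<and> last vs = hd vs0"
      using f(2) p(3) by (auto simp: doubleton_eq_iff)
    \<comment> \<open>\<open>cycle_path\<close> does not fix a direction; in the reversed case the
      roles of \<open>a\<close>, \<open>e\<close> and \<open>b\<close>, \<open>e'\<close> are
      exchanged.\<close>
    then have "detour k q a b e e' vs es \<or> detour k q b a e' e vs es"
      using D p(1,2) unfolding detour_def by (auto simp: insert_commute)
    then show ?thesis
      using spanning_cycle_Suc_ladder[OF F k _ _ p(2,4,3)] q QF by blast
  next
    case no_ladder: False
    have "\<forall>q\<in>Q. \<exists>a b e e' vs es. detour k q a b e e' vs es \<and> (\<forall>v\<in>set vs - {hd vs, last vs}. outward v)"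
    proof
      fix q assume q: "q \<in> Q"
      then obtain a b where ab: "ends G q = {a, b}" using Qends by blast
      have qC: "q \<in> C k" and out: "outward a" "outward b" using q QC Qout[OF q] ab by auto
      obtain e e' p p' where m: "a \<noteq> b" "a \<in> VC k" "b \<in> VC k"
        "e \<in> annulus_edges G C (Suc k)" "ends G e = {a, p}" "e' \<in> annulus_edges G C (Suc k)" "ends G e' = {b, p'}"
        "p \<noteq> p'" "p \<in> VC (Suc k)" "p' \<in> VC (Suc k)" "\<not> outward p" "\<not> outward p'"
        by (rule mates[OF k qC ab out])
      obtain vs es where "gpath G vs es" "hd vs = p" "last vs = p'" "set es \<subseteq> C (Suc k)"
          "\<forall>v\<in>set vs - {p, p'}. outward v"
        by (rule inward_free_arc[OF k qC ab m(4-7,9,10,8)])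
      then show "\<exists>a b e e' vs es. detour k q a b e e' vs es \<and> (\<forall>v\<in>set vs - {hd vs, last vs}. outward v)"
        using m ab unfolding detour_def by blast
    qed
    then obtain a b e e' vs es
      where d: "\<And>q. q \<in> Q \<Longrightarrow> detour k q (a q) (b q) (e q) (e' q) (vs q) (es q)"
        and int: "\<And>q. q \<in> Q \<Longrightarrow> \<forall>v\<in>set (vs q) - {hd (vs q), last (vs q)}. outward v"
      by metis
    note D = d[unfolded detour_def] and dp = detour_path[OF d k]
    \<comment> \<open>The ends of an arc are inward, so an outward vertex on it is interior.\<close>
    have inc: "g \<in> set (es q)" if "q \<in> Q" "v \<in> set (vs q)" "outward v" "g \<in> C (Suc k)" "v \<in> ends G g" for q v g
    proof -
      have "v \<noteq> hd (vs q)" "v \<noteq> last (vs q)" using D[OF that(1)] that(3) by auto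
      then show ?thesis using detour_incident[OF d[OF that(1)] k that(2) _ _ that(4,5)] by blast
    qed
    have es_ends: "ends G g \<subseteq> set (vs q)" if "q \<in> Q" "g \<in> set (es q)" for q g
      using dp(2)[OF that(1)] that(2) by (auto simp: vertices_on_def)
    \<comment> \<open>\<open>Q\<close> is a matching, so by \<open>detours_meet\<close> a common
      vertex is outward. By \<open>inc\<close> both arcs then contain both cycle edges at it, and
      the intersection spreads over the whole cycle, including the inward ends of the arcs.\<close>
    have disj: "set (vs q) \<inter> set (vs q') = {}" if q: "q \<in> Q" "q' \<in> Q" "q \<noteq> q'" for q q'
    proof (rule ccontr)
      assume ne: "set (vs q) \<inter> set (vs q') \<noteq> {}"
      have out: "outward v" if "v \<in> set (vs q) \<inter> set (vs q')" for v
        using detours_meet[OF k d[OF q(1)] d[OF q(2)], of v] that int q Qdisj[OF q] by blast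
      have "VC (Suc k) \<subseteq> set (vs q) \<inter> set (vs q')"
      proof (rule cycle_closed[OF simple C_cycle[OF kx(2)]])
        show "set (vs q) \<inter> set (vs q') \<inter> VC (Suc k) \<noteq> {}" using ne dp(3)[OF q(1)] by blast
        fix g assume g: "g \<in> C (Suc k)" "ends G g \<inter> (set (vs q) \<inter> set (vs q')) \<noteq> {}"
        then obtain v where v: "v \<in> ends G g" "v \<in> set (vs q)" "v \<in> set (vs q')" by blast
        then have "g \<in> set (es q)" "g \<in> set (es q')" using inc out g q by blast+
        then show "ends G g \<subseteq> set (vs q) \<inter> set (vs q')" using es_ends q by blast
      qed
      then have "outward (hd (vs q))" using out dp(3,4)[OF q(1)] by blast
      then show False using D[OF q(1)] by blast
    qed
    have cover: "VC (Suc k) \<subseteq> (\<Union>q\<in>Q. set (vs q))"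
    proof (rule cycle_closed[OF simple C_cycle[OF kx(2)]])
      \<comment> \<open>The edge from \<open>z\<close> leads to an outward vertex of
        \<open>C k\<close>, which is an end of some \<open>q\<close> in \<open>Q\<close>; hence
        \<open>z\<close> is an end of the arc for \<open>q\<close>.\<close>
      have covered: "z \<in> (\<Union>q\<in>Q. set (vs q))" if z: "z \<in> VC (Suc k)" "\<not> outward z" for z
      proof -
        obtain j g v where "Suc k = Suc j" and g0: "g \<in> annulus_edges G C (Suc k)" "ends G g = {v, z}"
            "v \<in> VC j" "outward v"
          using not_outwardE[OF z(2,1) kx(2)] by metis
        then have g: "g \<in> annulus_edges G C (Suc k)" "ends G g = {v, z}" "v \<in> VC k" "outward v" by auto
        obtain q where q: "q \<in> Q" "v \<in> ends G q" using Qcover g by blast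
        have "z \<noteq> v" using VC_disjoint[OF kx] g z by auto
        have "v = a q \<or> v = b q" using q(2) D[OF q(1)] by auto
        then have "z = hd (vs q) \<or> z = last (vs q)"
        proof
          assume "v = a q"
          then have "g = e q" using outward_unique[of k v g "e q"] k g D[OF q(1)] by auto
          then have "z = a q \<or> z = hd (vs q)" using g D[OF q(1)] by auto
          then show ?thesis using \<open>v = a q\<close> \<open>z \<noteq> v\<close> by simp
        next
          assume "v = b q"
          then have "g = e' q" using outward_unique[of k v g "e' q"] k g D[OF q(1)] by auto
          then have "z = b q \<or> z = last (vs q)" using g D[OF q(1)] by auto
          then show ?thesis using \<open>v = b q\<close> \<open>z \<noteq> v\<close> by simp
        qed
        then show ?thesis using q dp(4,5)[OF q(1)] by auto
      qed
      \<comment> \<open>A nonempty annulus yields an inward vertex on \<open>C (Suc k)\<close>, a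
        starting point for \<open>cycle_closed\<close>.\<close>
      obtain g where g: "g \<in> annulus_edges G C (Suc k)" using annulus_edges_nonempty[OF k] by blast
      obtain u where "u \<in> VC (Suc k)" "\<not> outward u" using annulus_edge_ends[OF g k] by metis
      then show "(\<Union>q\<in>Q. set (vs q)) \<inter> VC (Suc k) \<noteq> {}" using covered by blast
      fix g assume g: "g \<in> C (Suc k)" "ends G g \<inter> (\<Union>q\<in>Q. set (vs q)) \<noteq> {}"
      then obtain z q where z: "z \<in> ends G g" "q \<in> Q" "z \<in> set (vs q)" by blast
      show "ends G g \<subseteq> (\<Union>q\<in>Q. set (vs q))"
      proof (cases "outward z")
        case True
        then show ?thesis using inc[OF z(2,3) _ g(1) z(1)] es_ends z(2) by blast
      next
        case False
        have zV: "z \<in> VC (Suc k)" using C_ends[OF g(1)] z(1) by blast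
        obtain h where h: "h \<in> set (es q)" "z \<in> ends G h"
          using dp(2)[OF z(2)] z(3) unfolding vertices_on_def by blast
        obtain m where m: "m \<in> M'" "z \<in> ends G m" using M'(2)[OF zV] by blast
        have hC: "h \<in> C (Suc k)" using h D[OF z(2)] by blast
        \<comment> \<open>Here \<open>h\<close> is an arc edge and \<open>m\<close> the matching
          edge at the inward vertex \<open>z\<close>. If they were equal, the other end of
          \<open>h\<close> would also be inward, hence an end of the arc, and \<open>h\<close> would
          join the two ends of the arc: the case already excluded.\<close>
        have "h \<noteq> m"
        proof
          assume "h = m"
          obtain y where y: "ends G h = {z, y}" "y \<noteq> z"
          proof -
            have "card (ends G h) = 2" using ends_card C_edges[OF kx(2)] hC by blast
            then obtain u y where "ends G h = {u, y}" "u \<noteq> y" by (metis card_2_iff)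
            then show thesis using that[of u] that[of y] h(2) by (auto simp: insert_commute)
          qed
          then have "\<not> outward y" using M'(3)[of m z y] m \<open>h = m\<close> False by auto
          moreover have "y \<in> set (vs q)" using es_ends[OF z(2) h(1)] y by blast
          ultimately have "y \<in> {hd (vs q), last (vs q)}" "z \<in> {hd (vs q), last (vs q)}"
            using int[OF z(2)] z(3) False by blast+
          then have "ends G h = {hd (vs q), last (vs q)}" using y by auto
          then show False using no_ladder d[OF z(2)] z(2) hC by blast
        qed
        have c2: "card {e \<in> C (Suc k). z \<in> ends G e} = 2"
          using cycle_incident[OF simple C_cycle[OF kx(2)] zV] .
        \<comment> \<open>So the cycle edges at \<open>z\<close> are \<open>h\<close>, which stays
          on the arc, and \<open>m\<close>, whose ends are both inward and therefore
          covered.\<close>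
        have "{h, m} = {e \<in> C (Suc k). z \<in> ends G e}"
        proof (rule card_seteq)
          show "finite {e \<in> C (Suc k). z \<in> ends G e}" using c2 by (intro card_ge_0_finite) simp
          show "{h, m} \<subseteq> {e \<in> C (Suc k). z \<in> ends G e}" using h m hC M'(1) by blast
          show "card {e \<in> C (Suc k). z \<in> ends G e} \<le> card {h, m}" using c2 \<open>h \<noteq> m\<close> by simp
        qed
        then have "g = h \<or> g = m" using g z by blast
        then show ?thesis
        proof
          assume "g = h"
          then show ?thesis using es_ends[OF z(2) h(1)] z(2) by blast
        next
          assume "g = m"
          then have "\<not> outward y" if "y \<in> ends G g" for y using M'(3)[of m z y] m False that by simp
          then show ?thesis using covered C_ends[OF g(1)] by blast
        qed
      qed
    qed
    define us where "us q = a q # vs q @ [b q]" for q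
    define fs where "fs q = e q # es q @ [e' q]" for q
    have VF: "vertices_on G F = (\<Union>i\<le>k. VC i)" using F' by blast
    have new: "VC (Suc k) \<inter> vertices_on G F = {}" unfolding VF by (rule VC_Suc_disjoint[OF k])
    have us: "set (us q) = ends G q \<union> set (vs q)" if "q \<in> Q" for q
      using D[OF that] by (auto simp: us_def)
    have qV: "ends G q \<subseteq> vertices_on G F" if "q \<in> Q" for q
      using that QF by (auto simp: vertices_on_def)
    let ?F = "F - Q \<union> (\<Union>q\<in>Q. set (fs q))"
    have finQ: "finite Q" by (rule finite_subset[OF subset_trans[OF QC C_edges[OF kx(1)]] finite_edges])
    have r: "is_cycle G ?F \<and> vertices_on G ?F = vertices_on G F \<union> (\<Union>q\<in>Q. set (us q))"
    proof (rule cycle_replace_edges[OF simple _ finQ QF])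
      show "is_cycle G F" using F' by blast
      fix q assume q: "q \<in> Q"
      show "gpath G (us q) (fs q)" unfolding us_def fs_def by (rule dp(1)[OF q])
      show "ends G q = {hd (us q), last (us q)}" using D[OF q] by (simp add: us_def)
      show "2 \<le> length (fs q)" by (simp add: fs_def)
      show "set (us q) \<inter> vertices_on G F = ends G q"
        using us[OF q] qV[OF q] dp(3)[OF q] new by blast
      \<comment> \<open>Every edge of a detour has an end on \<open>C (Suc k)\<close>, while
        \<open>F\<close> stays on the earlier cycles.\<close>
      show "set (fs q) \<inter> F = {}"
      proof -
        have "ends G g \<inter> VC (Suc k) \<noteq> {}" if "g \<in> set (fs q)" for g
        proof -
          have "g \<in> set (es q) \<or> g = e q \<or> g = e' q" using that by (auto simp: fs_def)
          then show ?thesis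
          proof (elim disjE)
            assume "g \<in> set (es q)"
            then have "g \<in> C (Suc k)" using D[OF q] by blast
            moreover have "card (ends G g) = 2" using calculation ends_card C_edges[OF kx(2)] by blast
            then have "ends G g \<noteq> {}" by auto
            ultimately show ?thesis using C_ends by blast
          qed (use D[OF q] dp(3-5)[OF q] in blast)+
        qed
        moreover have "ends G g \<subseteq> vertices_on G F" if "g \<in> F" for g
          using that by (auto simp: vertices_on_def)
        ultimately show ?thesis using new by blast
      qed
      fix q' assume q': "q' \<in> Q" "q \<noteq> q'"
      show "set (us q) \<inter> set (us q') \<subseteq> vertices_on G F"
        using us[OF q] us[OF q'(1)] disj[OF q q'] qV[OF q] qV[OF q'(1)] by blast
    qed
    have "(\<Union>q\<in>Q. set (vs q)) = VC (Suc k)" using cover dp(3) by blast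
    then have "vertices_on G F \<union> (\<Union>q\<in>Q. set (us q)) = vertices_on G F \<union> VC (Suc k)"
      using us qV by blast
    then have "vertices_on G ?F = (\<Union>i\<le>Suc k. VC i)"
      using r VF by (simp add: atMost_Suc Un_commute)
    \<comment> \<open>The last clause of the invariant: by \<open>inc\<close>, the arc through an
      outward vertex contains both cycle edges at it.\<close>
    moreover have "g \<in> ?F" if g: "g \<in> C (Suc k)" "v \<in> ends G g" "outward v" for g v
    proof -
      have "v \<in> VC (Suc k)" using C_ends g by blast
      then obtain q where q: "q \<in> Q" "v \<in> set (vs q)" using cover by blast
      then have "g \<in> set (es q)" using inc g by blast
      then show ?thesis using q(1) by (auto simp: fs_def)
    qed
    ultimately have "spanning_cycle (Suc k) ?F" using r unfolding spanning_cycle_def by blast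
    then show ?thesis by blast
  qed
qed

text \<open>The induction starts with \<open>C 0\<close>, which contains all its own edges, and at
  \<open>k = x\<close> the cycle passes through all vertices by \<open>verts_eq\<close>.\<close>

theorem hamiltonian: "hamiltonian G"
proof -
  have "\<exists>F. spanning_cycle k F" if "k \<le> x" for k
    using that
  proof (induction k)
    case 0
    have "spanning_cycle 0 (C 0)" using C_cycle[of 0] unfolding spanning_cycle_def by simp
    then show ?case by blast
  next
    case (Suc k)
    then show ?case using spanning_cycle_Suc by auto
  qed
  then show ?thesis unfolding hamiltonian_def spanning_cycle_def verts_eq by blast
qed

end

section \<open>The theorem for ADB-AC graphs\<close>

theorem theorem3p5:
  fixes G :: "('v, 'e) mgraph"
    and pt :: "'v \<Rightarrow> complex" and cv :: "'e \<Rightarrow> complex set"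
    and C :: "nat \<Rightarrow> 'e set" and x :: nat
  assumes "adb_ac_graph G pt cv C x"
    and "\<forall>k\<in>{1..x}. ring_annulus G pt cv C k \<or> block_annulus G pt cv C k"
    and "\<forall>i j. enclosed_ring_run G pt cv C x i j \<longrightarrow> 2 \<le> card {i..j}"
  shows "hamiltonian G"
proof -
  have B: "barnette G" and emb: "annular_embedding G pt cv C x"
    and ac: "\<forall>k\<in>{1..x}. suppresses_to_two_barnette (del_edges G (annulus_edges G C k)) \<or>
                 suppresses_to_barnette_and_curve (del_edges G (annulus_edges G C k))"
    using assms(1) unfolding adb_ac_graph_def adb_graph_def by simp_all
  \<comment> \<open>Connectivity of \<open>G\<close> is read off from 3-connectivity by deleting the
    empty set; the induced graph on all vertices keeps every edge.\<close>
  have "{e \<in> edges G. ends G e \<subseteq> verts G} = edges G"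
    using B unfolding barnette_def simple_graph_def wf_mgraph_def by blast
  moreover have "connected_graph (induced G (verts G - {}))"
    using B unfolding barnette_def k_connected_def by (metis card.empty empty_subsetI zero_less_numeral)
  ultimately have conn: "connected_graph G" by (simp add: connected_graph_def induced_def)
  interpret annular_connected G pt cv C x
  proof
    show "simple_graph G" "regular 3 G" "bipartite G" using B unfolding barnette_def by auto
    show "plane_embedding G pt cv" using emb unfolding annular_embedding_def by simp
    show "suppresses_to_two_barnette (del_edges G (annulus_edges G C (Suc k))) \<or>
      suppresses_to_barnette_and_curve (del_edges G (annulus_edges G C (Suc k)))" if "k < x" for k
      using ac that by simp
  qed (fact conn emb)+
  show ?thesis by (rule hamiltonian)
qed

end
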